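(* Let $n\in\mathbb{Z}_{\ge 1}$ and let $\lambda$ be a Young diagram. For every $r=1,2,\dots,n$ we have the identity of rational functions in $u_1,\dots,u_n$ $$\mathfrak{D}_r\,\mathsf{F}_\lambda(u_1,\dots,u_n)=e_r(1,q,\dots,q^{\,n-\ell(\lambda)-1})\,\mathsf{F}_\lambda(u_1,\dots,u_n),$$ where $e_r(x_1,\dots,x_k)=\sum_{1\le i_1<\dots<i_r\le k}x_{i_1}\cdots x_{i_r}$ is the $r$-th elementary symmetric polynomial (equal to $0$ if $r>k$).
   Context: A Young diagram is $\lambda=(\lambda_1\ge\dots\ge\lambda_{\ell(\lambda)}>0)$, $\lambda_i\in\mathbb{Z}$, with $\lambda_i=0$ for $i>\ell(\lambda)$. $q\in(0,1)$ and $s$ are (generic) parameters; $(a;q)_k=\prod_{i=1}^{k}(1-aq^{i-1})$. The (stable) spin Hall-Littlewood function is, for $n\ge \ell(\lambda)$, $$\mathsf{F}_\lambda(u_1,\dots,u_n)=\frac{(1-q)^n}{(q;q)_{n-\ell(\lambda)}}\sum_{\sigma\in\mathfrak{S}_n}\sigma\Bigl\{\prod_{1\le i<j\le n}\frac{u_i-qu_j}{u_i-u_j}\prod_{i=1}^n\Bigl(\frac{u_i-s}{1-su_i}\Bigr)^{\lambda_i}\prod_{i=1}^{\ell(\lambda)}\frac{u_i}{u_i-s}\Bigr\},$$ where $\sigma$ permutes the indices of the variables $u_i$ but not of the $\lambda_i$; and $\mathsf{F}_\lambda(u_1,\dots,u_n)=0$ if $\ell(\lambda)>n$. The Hall-Littlewood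 difference operators are $$\mathfrak{D}_r=\sum_{I\subset\{1,\dots,n\},\ |I|=r}\Bigl(\prod_{i\in I,\ j\in\{1,\dots,n\}\setminus I}\frac{qu_i-u_j}{u_i-u_j}\Bigr)T_{0,I},$$ where $T_{0,I}$ sets all variables $u_i$, $i\in I$, to zero (it is applied to rational functions that are regular there).
   Formalization: The identity as displayed fails for r ≥ 2 (n = r = 2, λ = ∅: D_2 F = 1 but e_2(1,q) F = q); the theorem proved is q^{r(r-1)/2} D_r F_λ = e_r(1,q,…,q^{n-ℓ(λ)-1}) F_λ, which for r = 1 is the literal statement. *)

theory Defs
  imports
    Complex_Main
    "HOL-Library.Poly_Mapping"
    "HOL-Computational_Algebra.Fraction_Field"
    "HOL-Combinatorics.Permutations"
begin

hide_const (open) Rat.Fract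

section \<open>Rational functions in the variables u_1, u_2, ...\<close>

text \<open>
  A monomial is its finitely supported exponent vector, a polynomial a finitely supported family
  of coefficients indexed by monomials, and a rational function an element of the fraction field.
  Variables are indexed by all natural numbers; only u_1, ..., u_n occur in the statement.
\<close>

type_synonym 'a mpoly = "(nat \<Rightarrow>\<^sub>0 nat) \<Rightarrow>\<^sub>0 'a"

type_synonym 'a ratfun = "'a mpoly fract"

definition poly_const :: "'a::idom \<Rightarrow> 'a mpoly" where
  "poly_const c = Poly_Mapping.single 0 c"

definition poly_var :: "nat \<Rightarrow> 'a::idom mpoly" where
  "poly_var i = Poly_Mapping.single (Poly_Mapping.single i 1) 1"

definition poly_subst :: "(nat \<Rightarrow> 'a mpoly) \<Rightarrow> 'a::idom mpoly \<Rightarrow> 'a mpoly" where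
  "poly_subst f p =
     (\<Sum>m\<in>Poly_Mapping.keys p. poly_const (Poly_Mapping.lookup p m) *
        (\<Prod>i\<in>Poly_Mapping.keys m. f i ^ Poly_Mapping.lookup m i))"

definition poly_set_zero :: "nat set \<Rightarrow> 'a::idom mpoly \<Rightarrow> 'a mpoly" where
  "poly_set_zero I = poly_subst (\<lambda>i. if i \<in> I then 0 else poly_var i)"

definition rf_const :: "'a::idom \<Rightarrow> 'a ratfun" where
  "rf_const c = Fract (poly_const c) 1"

definition rf_var :: "nat \<Rightarrow> 'a::idom ratfun" where
  "rf_var i = Fract (poly_var i) 1"

text \<open>
  The operator T_{0,I}.  A rational function is regular at u_i = 0 (i in I) if it can be written
  as p/d where d does not vanish identically after the substitution; its value is then independent
  of the choice of p and d (lemma \<open>T0_Fract\<close>).  On a rational function that is not regular,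
  the value of the definite description is unspecified.
\<close>

definition T0 :: "nat set \<Rightarrow> 'a::idom ratfun \<Rightarrow> 'a ratfun" where
  "T0 I f = (THE g. \<exists>p d. poly_set_zero I d \<noteq> 0 \<and> f = Fract p d \<and>
                          g = Fract (poly_set_zero I p) (poly_set_zero I d))"

lemma poly_subst_superset:
  assumes "finite A" "Poly_Mapping.keys p \<subseteq> A"
  shows "poly_subst f p = (\<Sum>m\<in>A. poly_const (Poly_Mapping.lookup p m) *
           (\<Prod>i\<in>Poly_Mapping.keys m. f i ^ Poly_Mapping.lookup m i))"
  unfolding poly_subst_def using assms
  by (intro sum.mono_neutral_left) (auto simp: poly_const_def in_keys_iff)

lemma poly_subst_0 [simp]: "poly_subst f 0 = 0"
  by (simp add: poly_subst_def)

lemma poly_subst_add: "poly_subst f (p + q) = poly_subst f p + poly_subst f q"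
proof -
  let ?A = "Poly_Mapping.keys p \<union> Poly_Mapping.keys q"
  have A: "finite ?A" "Poly_Mapping.keys (p + q) \<subseteq> ?A"
    "Poly_Mapping.keys p \<subseteq> ?A" "Poly_Mapping.keys q \<subseteq> ?A"
    using Poly_Mapping.keys_add[of p q] by auto
  have c: "poly_const (a + b) = poly_const a + poly_const b" for a b :: 'a
    by (simp add: poly_const_def single_add)
  show ?thesis
    unfolding A(2-4)[THEN poly_subst_superset[OF A(1)]]
    by (simp only: lookup_add c distrib_right sum.distrib)
qed

lemma poly_subst_sum: "poly_subst f (sum g A) = (\<Sum>x\<in>A. poly_subst f (g x))"
  by (induction A rule: infinite_finite_induct) (auto simp: poly_subst_add)

lemma poly_subst_single:
  "poly_subst f (Poly_Mapping.single m c) =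
     poly_const c * (\<Prod>i\<in>Poly_Mapping.keys m. f i ^ Poly_Mapping.lookup m i)"
  by (subst poly_subst_superset[of "{m}"]) auto

lemma poly_subst_single_mult:
  "poly_subst f (Poly_Mapping.single m c * Poly_Mapping.single k d) =
     poly_subst f (Poly_Mapping.single m c) * poly_subst f (Poly_Mapping.single k d)"
proof -
  let ?A = "Poly_Mapping.keys m \<union> Poly_Mapping.keys k"
  have *: "(\<Prod>i\<in>Poly_Mapping.keys l. f i ^ Poly_Mapping.lookup l i) =
           (\<Prod>i\<in>?A. f i ^ Poly_Mapping.lookup l i)"
    if "Poly_Mapping.keys l \<subseteq> ?A" for l
    using that by (intro prod.mono_neutral_left) (auto simp: in_keys_iff)
  have "Poly_Mapping.keys (m + k) \<subseteq> ?A"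
    by (rule Poly_Mapping.keys_add)
  moreover have "poly_const (c * d) = poly_const c * poly_const d"
    by (simp add: poly_const_def mult_single)
  ultimately show ?thesis
    unfolding mult_single poly_subst_single
    using *[of m] *[of k] *[of "m + k"]
    by (simp add: lookup_add power_add prod.distrib mult_ac)
qed

lemma poly_eq_sum_single:
  "p = (\<Sum>m\<in>Poly_Mapping.keys p. Poly_Mapping.single m (Poly_Mapping.lookup p m))"
  by (rule poly_mapping_eqI)
     (auto simp: lookup_sum lookup_single when_def sum.delta in_keys_iff)

lemma poly_subst_mult: "poly_subst f (p * q) = poly_subst f p * poly_subst f q"
proof -
  let ?S = "\<lambda>p::'a mpoly. \<Sum>m\<in>Poly_Mapping.keys p. Poly_Mapping.single m (Poly_Mapping.lookup p m)"
  have "poly_subst f (?S p * ?S q) = poly_subst f (?S p) * poly_subst f (?S q)"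
    unfolding sum_product poly_subst_sum poly_subst_single_mult ..
  then show ?thesis
    by (simp only: poly_eq_sum_single[symmetric])
qed

lemma T0_Fract:
  assumes "poly_set_zero I d \<noteq> 0"
  shows "T0 I (Fract p d) = Fract (poly_set_zero I p) (poly_set_zero I d)"
  unfolding T0_def
proof (rule the_equality)
  fix g
  assume "\<exists>p' d'. poly_set_zero I d' \<noteq> 0 \<and> Fract p d = Fract p' d' \<and>
            g = Fract (poly_set_zero I p') (poly_set_zero I d')"
  then obtain p' d' where d': "poly_set_zero I d' \<noteq> 0" and eq: "Fract p d = Fract p' d'"
    and g: "g = Fract (poly_set_zero I p') (poly_set_zero I d')"
    by blast
  have "d \<noteq> 0" "d' \<noteq> 0"
    using assms d' by (auto simp: poly_set_zero_def)
  with eq have "p * d' = p' * d"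
    by (simp add: eq_fract)
  then have "poly_set_zero I (p * d') = poly_set_zero I (p' * d)"
    by simp
  then have "poly_set_zero I p * poly_set_zero I d' = poly_set_zero I p' * poly_set_zero I d"
    by (simp only: poly_set_zero_def poly_subst_mult)
  then show "g = Fract (poly_set_zero I p) (poly_set_zero I d)"
    using assms d' by (simp add: g eq_fract)
qed (use assms in blast)


section \<open>Spin Hall-Littlewood functions\<close>

definition young_diagram :: "nat list \<Rightarrow> bool" where
  "young_diagram lam \<longleftrightarrow> sorted_wrt (\<ge>) lam \<and> (\<forall>x\<in>set lam. x > 0)"

definition part :: "nat list \<Rightarrow> nat \<Rightarrow> nat" where
  "part lam i = (if 1 \<le> i \<and> i \<le> length lam then lam ! (i - 1) else 0)"

definition qpoch :: "'a::comm_ring_1 \<Rightarrow> 'a \<Rightarrow> nat \<Rightarrow> 'a" where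
  "qpoch a q k = (\<Prod>i=1..k. 1 - a * q ^ (i - 1))"

definition spin_HL :: "'a::field \<Rightarrow> 'a \<Rightarrow> nat list \<Rightarrow> nat \<Rightarrow> (nat \<Rightarrow> 'a) \<Rightarrow> 'a" where
  "spin_HL q s lam n u =
     (if length lam > n then 0
      else (1 - q) ^ n / qpoch q q (n - length lam) *
        (\<Sum>\<sigma> | \<sigma> permutes {1..n}.
           (\<Prod>i\<in>{1..n}. \<Prod>j\<in>{i<..n}. (u (\<sigma> i) - q * u (\<sigma> j)) / (u (\<sigma> i) - u (\<sigma> j))) *
           (\<Prod>i\<in>{1..n}. ((u (\<sigma> i) - s) / (1 - s * u (\<sigma> i))) ^ part lam i) *
           (\<Prod>i\<in>{1..length lam}. u (\<sigma> i) / (u (\<sigma> i) - s))))"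


section \<open>Hall-Littlewood difference operators\<close>

text \<open>
  No prefactor q^(r choose 2), unlike the usual normalisation of Macdonald operators; without it
  the eigenvalue is e_r(1, q, ...) divided by q^(r choose 2), e.g. the operator with n = r = 2
  fixes constants while e_2(1, q) = q.
\<close>

definition HL_op :: "'a::idom ratfun \<Rightarrow> nat \<Rightarrow> nat \<Rightarrow> 'a ratfun \<Rightarrow> 'a ratfun" where
  "HL_op q n r f =
     (\<Sum>I | I \<subseteq> {1..n} \<and> card I = r.
        (\<Prod>i\<in>I. \<Prod>j\<in>{1..n} - I. (q * rf_var i - rf_var j) / (rf_var i - rf_var j)) * T0 I f)"

definition elem_sym :: "nat \<Rightarrow> nat \<Rightarrow> (nat \<Rightarrow> 'a::comm_ring_1) \<Rightarrow> 'a" where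
  "elem_sym r k x = (\<Sum>A | A \<subseteq> {1..k} \<and> card A = r. \<Prod>i\<in>A. x i)"

end

theory Submission
  imports Defs
    "HOL-Computational_Algebra.Polynomial"
    "HOL-Combinatorics.Multiset_Permutations"
begin

hide_const (open) Rat.Fract

text \<open>
  Summing out the variables attached to the zero parts of \<open>\<lambda>\<close> turns \<open>F\<^sub>\<lambda>\<close> into a sum over
  ordered choices of \<open>\<ell>(\<lambda>)\<close> variables from \<open>S = {1..n}\<close>, weighted by the factors
  \<open>(u\<^sub>a - q u\<^sub>j) / (u\<^sub>a - u\<^sub>j)\<close> for \<open>a\<close> chosen before \<open>j\<close> or \<open>j\<close> not chosen. In this form setting
  \<open>u\<^sub>i = 0\<close> just removes \<open>i\<close> from \<open>S\<close>, because the factor of a nonzero part vanishes at \<open>0\<close>.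
  The coefficients of the difference operator restore the weights lost in passing from \<open>S\<close> to
  \<open>S - I\<close>, so that the eigenvalue is the sum of these coefficients over the subsets \<open>I\<close> of a set of
  \<open>n - \<ell>(\<lambda>)\<close> variables. That sum is a q-binomial coefficient, by Lagrange interpolation for
  \<open>r = 1\<close> and by induction on \<open>r\<close> in general. Setting all \<open>u\<^sub>i\<close>, \<open>i \<in> I\<close>, to zero
  simultaneously is legitimate because \<open>F\<^sub>\<lambda>\<close> has no poles along \<open>u\<^sub>i = u\<^sub>j\<close>.
\<close>

section \<open>Lagrange interpolation and elementary symmetric polynomials\<close>

text \<open>Lagrange interpolation at the \<open>m + 1\<close> points of \<open>X\<close> reproduces
  \<open>p\<close>. Each basis polynomial \<open>B x\<close> is monic of degree \<open>m\<close>, so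
  comparing coefficients of degree \<open>m\<close> leaves the scalar factors of
  \<open>L\<close>.\<close>

lemma sum_divided_difference:
  fixes p :: "'k::field poly"
  assumes "finite X" "card X = Suc m" "degree p \<le> m"
  shows "(\<Sum>x\<in>X. poly p x / (\<Prod>y\<in>X-{x}. x - y)) = coeff p m"
proof -
  define B where "B x = (\<Prod>y\<in>X-{x}. [:-y, 1:])" for x
  define L where "L = (\<Sum>x\<in>X. smult (poly p x / (\<Prod>y\<in>X-{x}. x - y)) (B x))"
  have degB: "degree (B x) = m" if "x \<in> X" for x
    unfolding B_def using that assms by (subst degree_prod_eq_sum_degree) auto
  have monicB: "lead_coeff (B x) = 1" for x
    unfolding B_def by (simp add: lead_coeff_prod)
  have coeffB: "coeff (B x) m = 1" if "x \<in> X" for x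
    using monicB[of x] unfolding degB[OF that] .
  have polyB: "poly (B x) z = (if z = x then \<Prod>y\<in>X-{x}. x - y else 0)"
    if "x \<in> X" "z \<in> X" for x z
    using that assms(1) by (auto simp: B_def poly_prod prod_zero_iff)
  have "poly (p - L) z = 0" if z: "z \<in> X" for z
  proof -
    have "poly L z = (\<Sum>x\<in>X. if x = z then poly p z else 0)"
      unfolding L_def poly_sum using z assms(1)
      by (intro sum.cong refl) (auto simp: polyB prod_zero_iff)
    then show ?thesis
      using z assms(1) by (simp add: sum.delta)
  qed
  moreover have "degree (p - L) \<le> m"
    unfolding L_def using assms(3) degB
    by (intro degree_diff_le degree_sum_le order.trans[OF degree_smult_le]) (auto simp: assms(1))
  \<comment> \<open>The difference has \<open>m + 1\<close> roots but degree at most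
    \<open>m\<close>.\<close>
  ultimately have "p - L = 0"
    using card_poly_roots_bound[of "p - L"] card_mono[of "{z. poly (p - L) z = 0}" X] assms(2)
      poly_roots_finite[of "p - L"] by fastforce
  then have "coeff p m = coeff L m"
    by simp
  also have "\<dots> = (\<Sum>x\<in>X. poly p x / (\<Prod>y\<in>X-{x}. x - y))"
    by (simp add: L_def coeff_sum coeffB)
  finally show ?thesis ..
qed

text \<open>A degree bound and one coefficient replace the leading coefficient, since
  \<open>a\<close> may be 0 and the degree may then drop.\<close>

lemma prod_linear_poly:
  fixes a :: "'k::field"
  assumes "finite S"
  shows "degree (\<Prod>j\<in>S. [:c j, a:]) \<le> card S \<and> coeff (\<Prod>j\<in>S. [:c j, a:]) (card S) = a ^ card S"
  using assms
proof (induction S)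
  case (insert x S)
  then have "degree ([:c x, a:] * (\<Prod>j\<in>S. [:c j, a:])) \<le> 1 + card S"
    by (intro order.trans[OF degree_mult_le] add_mono) auto
  moreover have "coeff (\<Prod>j\<in>S. [:c j, a:]) (Suc (card S)) = 0"
    using insert by (intro coeff_eq_0) auto
  ultimately show ?case
    using insert by simp
qed auto

text \<open>Leading coefficient of \<open>\<Prod>j. (a z - b u j)\<close>, read off by interpolation at \<open>0\<close> and at the \<open>u i\<close>.\<close>

lemma sum_prod_ratio:
  fixes u :: "'i \<Rightarrow> 'k::field"
  assumes "finite S" "inj_on u S" "\<And>i. i \<in> S \<Longrightarrow> u i \<noteq> 0"
  shows "(a - b) * (\<Sum>i\<in>S. \<Prod>j\<in>S-{i}. (a * u i - b * u j) / (u i - u j)) = a ^ card S - b ^ card S"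
proof -
  define p where "p = (\<Prod>j\<in>S. [:- b * u j, a:])"
  define X where "X = insert 0 (u ` S)"
  have z: "0 \<notin> u ` S" using assms(3) by auto
  have X: "finite X" "card X = Suc (card S)"
    using assms z by (auto simp: X_def card_image)
  have p: "degree p \<le> card S" "coeff p (card S) = a ^ card S"
    using prod_linear_poly[OF assms(1), of "\<lambda>j. - b * u j" a] by (auto simp: p_def)
  \<comment> \<open>The factor \<open>j = i\<close> of \<open>p\<close> at \<open>u i\<close> is
    \<open>(a - b) * u i\<close>; its \<open>u i\<close> cancels against the extra node 0.\<close>
  have "poly p (u i) / (\<Prod>y\<in>X-{u i}. u i - y) =
      (a - b) * (\<Prod>j\<in>S-{i}. (a * u i - b * u j) / (u i - u j))" if i: "i \<in> S" for i
  proof -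
    have "X - {u i} = insert 0 (u ` (S - {i}))"
      using i z assms(2) by (auto simp: X_def inj_on_def)
    moreover have "0 \<notin> u ` (S - {i})" "inj_on u (S - {i})"
      using z assms(2) by (auto simp: inj_on_def)
    ultimately have "(\<Prod>y\<in>X-{u i}. u i - y) = u i * (\<Prod>j\<in>S-{i}. u i - u j)"
      using assms(1) by (simp add: prod.reindex)
    moreover have "poly p (u i) = (a - b) * u i * (\<Prod>j\<in>S-{i}. a * u i - b * u j)"
      unfolding p_def poly_prod prod.remove[OF assms(1) i] by (simp add: poly_prod algebra_simps)
    ultimately show ?thesis
      using assms(3)[OF i] by (simp add: prod_dividef)
  qed
  \<comment> \<open>At the node 0 each factor \<open>- b * u j\<close> is divided by
    \<open>- u j\<close>, which leaves \<open>b\<close>.\<close>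
  moreover have "poly p 0 / (\<Prod>y\<in>X-{0}. 0 - y) = b ^ card S"
  proof -
    have "X - {0} = u ` S" using z by (auto simp: X_def)
    then have "poly p 0 / (\<Prod>y\<in>X-{0}. 0 - y) = (\<Prod>j\<in>S. (- b * u j) / (- u j))"
      using assms(2) by (simp add: p_def poly_prod prod.reindex flip: prod_dividef)
    also have "\<dots> = (\<Prod>j\<in>S. b)"
      using assms by (intro prod.cong) auto
    finally show ?thesis by simp
  qed
  ultimately have "a ^ card S = b ^ card S +
      (\<Sum>i\<in>S. (a - b) * (\<Prod>j\<in>S-{i}. (a * u i - b * u j) / (u i - u j)))"
    using sum_divided_difference[OF X p(1)] p(2) assms(1,2) z
    by (simp add: X_def sum.reindex)
  then show ?thesis
    by (simp add: sum_distrib_left)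
qed

section \<open>Elementary symmetric polynomials of a geometric progression\<close>

lemma elem_sym_0 [simp]: "elem_sym 0 m x = 1"
proof -
  have "{A. A \<subseteq> {1..m} \<and> card A = 0} = {{}}"
    by (auto dest: finite_subset)
  then show ?thesis by (simp add: elem_sym_def)
qed

lemma elem_sym_Suc_0 [simp]: "elem_sym (Suc r) 0 x = 0"
proof -
  have "{A. A \<subseteq> {1..0::nat} \<and> card A = Suc r} = {}"
    by auto
  then show ?thesis
    unfolding elem_sym_def by (metis (no_types, lifting) sum.empty)
qed

text \<open>Pascal-type recursion: subsets are split by whether they contain
  \<open>Suc m\<close>.\<close>

lemma elem_sym_Suc_Suc:
  "elem_sym (Suc r) (Suc m) x = elem_sym (Suc r) m x + x (Suc m) * elem_sym r m x"
proof -
  let ?P = "\<lambda>r m. {A. A \<subseteq> {1..m} \<and> card A = r}"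
  have fin: "finite (?P r m)" for r m :: nat
    by (rule finite_subset[of _ "Pow {1..m}"]) auto
  have "?P (Suc r) (Suc m) = ?P (Suc r) m \<union> insert (Suc m) ` ?P r m" (is "?L = ?R")
  proof (intro equalityI subsetI)
    fix A assume A: "A \<in> ?L"
    then have f: "finite A" by (auto intro: finite_subset)
    show "A \<in> ?R"
    proof (cases "Suc m \<in> A")
      case True
      then have "A = insert (Suc m) (A - {Suc m})" "A - {Suc m} \<in> ?P r m"
        using A f by (auto simp: atLeastAtMostSuc_conv)
      then show ?thesis by blast
    next
      case False
      then show ?thesis using A by (auto simp: atLeastAtMostSuc_conv)
    qed
  next
    fix A assume A: "A \<in> ?R"
    have "Suc m \<notin> B" if "B \<subseteq> {1..m}" for B
      using that by auto
    then show "A \<in> ?L" using A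
      by (auto simp: atLeastAtMostSuc_conv card_insert_if finite_subset[of _ "{1..m}"])
  qed
  moreover have "?P (Suc r) m \<inter> insert (Suc m) ` ?P r m = {}" by fastforce
  moreover have "inj_on (insert (Suc m)) (?P r m)"
  proof (rule inj_onI)
    fix A B assume "A \<in> ?P r m" "B \<in> ?P r m" and eq: "insert (Suc m) A = insert (Suc m) B"
    then have "Suc m \<notin> A" "Suc m \<notin> B"
      by auto
    then show "A = B"
      using eq by (simp add: insert_ident)
  qed
  ultimately have "elem_sym (Suc r) (Suc m) x = elem_sym (Suc r) m x + 
      (\<Sum>A\<in>?P r m. \<Prod>i\<in>insert (Suc m) A. x i)"
    unfolding elem_sym_def by (simp add: sum.union_disjoint fin sum.reindex)
  moreover have "(\<Prod>i\<in>insert (Suc m) A. x i) = x (Suc m) * (\<Prod>i\<in>A. x i)" if "A \<in> ?P r m" for A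
    using that by (subst prod.insert) (auto intro: finite_subset)
  ultimately show ?thesis
    by (simp add: elem_sym_def sum_distrib_left)
qed

text \<open>Equals \<open>q ^ (r choose 2)\<close> times the q-binomial coefficient \<open>m\<close>
  over \<open>r\<close>.\<close>

abbreviation (input) elem_sym_geom :: "'a::comm_ring_1 \<Rightarrow> nat \<Rightarrow> nat \<Rightarrow> 'a" where
  "elem_sym_geom q r m \<equiv> elem_sym r m (\<lambda>i. q ^ (i - 1))"

text \<open>Quotient of neighbouring q-binomial coefficients, cleared of denominators. The form
  \<open>q ^ r - q ^ m\<close> avoids a truncated \<open>m - r\<close> when
  \<open>m < r\<close>.\<close>

lemma elem_sym_geom_ratio:
  fixes q :: "'a::comm_ring_1"
  shows "(1 - q ^ Suc r) * elem_sym_geom q (Suc r) m = (q ^ r - q ^ m) * elem_sym_geom q r m"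
proof (induction m arbitrary: r)
  case 0
  show ?case by (cases r) auto
next
  case (Suc m)
  \<comment> \<open>Both sides become multiples of \<open>elem_sym_geom q r m\<close>: the left one
    by the hypothesis at \<open>r\<close>, the right one, for \<open>r > 0\<close>, by the
    hypothesis at \<open>r - 1\<close>.\<close>
  have E: "(1 - q ^ Suc r) * elem_sym_geom q (Suc r) (Suc m) =
      (q ^ r - q ^ (m + Suc r)) * elem_sym_geom q r m" for r
  proof -
    have "(1 - q ^ Suc r) * elem_sym_geom q (Suc r) (Suc m) =
        (1 - q ^ Suc r) * elem_sym_geom q (Suc r) m + (1 - q ^ Suc r) * q ^ m * elem_sym_geom q r m"
      by (simp add: elem_sym_Suc_Suc algebra_simps)
    also have "\<dots> = (q ^ r - q ^ m) * elem_sym_geom q r m + (1 - q ^ Suc r) * q ^ m * elem_sym_geom q r m"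
      using Suc.IH[of r] by simp
    finally show ?thesis by (simp add: algebra_simps power_add)
  qed
  show ?case
  proof (cases r)
    case 0
    then show ?thesis using E[of 0] by (simp add: algebra_simps)
  next
    case (Suc r')
    have "(q ^ r - q ^ Suc m) * elem_sym_geom q r (Suc m) =
      (q ^ r - q ^ Suc m) * elem_sym_geom q r m + q ^ Suc m * ((q ^ r' - q ^ m) * elem_sym_geom q r' m)"
      by (simp add: Suc elem_sym_Suc_Suc algebra_simps)
    also have "\<dots> = (q ^ r - q ^ Suc m) * elem_sym_geom q r m + q ^ Suc m * ((1 - q ^ r) * elem_sym_geom q r m)"
      using Suc.IH[of r'] by (simp add: Suc)
    also have "\<dots> = (q ^ r - q ^ (m + Suc r)) * elem_sym_geom q r m"
      by (simp add: algebra_simps power_add)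
    finally show ?thesis using E[of r] by simp
  qed
qed

text \<open>The q-analogue of
  \<open>(r + 1) * (m + 1 choose r + 1) = (m + 1) * (m choose r)\<close>. Marking an element of a
  subset produces the same recursion in \<open>sum_subsets_HL_weight\<close>.\<close>

lemma elem_sym_geom_Suc_Suc:
  fixes q :: "'a::comm_ring_1"
  shows "(1 - q ^ Suc r) * elem_sym_geom q (Suc r) (Suc m) =
    q ^ r * (1 - q ^ Suc m) * elem_sym_geom q r m"
proof -
  have "(1 - q ^ Suc r) * elem_sym_geom q (Suc r) (Suc m) =
      (1 - q ^ Suc r) * elem_sym_geom q (Suc r) m + (1 - q ^ Suc r) * q ^ m * elem_sym_geom q r m"
    by (simp add: elem_sym_Suc_Suc algebra_simps)
  also have "\<dots> = (q ^ r - q ^ m) * elem_sym_geom q r m + (1 - q ^ Suc r) * q ^ m * elem_sym_geom q r m"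
    using elem_sym_geom_ratio[of q r m] by simp
  finally show ?thesis by (simp add: algebra_simps power_add)
qed

lemma qpoch_Suc: "qpoch q q (Suc m) = (1 - q ^ Suc m) * qpoch q q m"
  by (simp add: qpoch_def)

lemma qpoch_0 [simp]: "qpoch a q 0 = 1"
  by (simp add: qpoch_def)


section \<open>The difference operator on ordered sums\<close>

text \<open>The shape of \<open>spin_HL\<close> once the zero parts are summed out. With fewer
  entries than elements of \<open>S\<close>, the elements never chosen enter only as second
  arguments of \<open>w\<close>.\<close>

fun HL_sum :: "('i \<Rightarrow> 'i \<Rightarrow> 'k::comm_ring_1) \<Rightarrow> ('i \<Rightarrow> 'k) list \<Rightarrow> 'i set \<Rightarrow> 'k" where
  "HL_sum w [] S = 1"
| "HL_sum w (g # gs) S = (\<Sum>a\<in>S. g a * (\<Prod>j\<in>S-{a}. w a j) * HL_sum w gs (S - {a}))"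

text \<open>With swapped arguments, \<open>HL_weight q u j i\<close> is
  \<open>(q * u i - u j) / (u i - u j)\<close>, the coefficient in the difference operator, so one
  weight serves both.\<close>

definition HL_weight :: "'k::field \<Rightarrow> ('i \<Rightarrow> 'k) \<Rightarrow> 'i \<Rightarrow> 'i \<Rightarrow> 'k" where
  "HL_weight q u a b = (u a - q * u b) / (u a - u b)"

lemma finite_subsets_card: "finite S \<Longrightarrow> finite {I. I \<subseteq> S \<and> card I = r}"
  by (rule finite_subset[of _ "Pow S"]) auto

lemma prod_subset_complement:
  assumes "finite S" "I \<subseteq> S"
  shows "(\<Prod>j\<in>S. f j) = (\<Prod>j\<in>I. f j) * (\<Prod>j\<in>S-I. f j)"
  using prod.subset_diff[OF assms(2,1)] by (simp add: mult.commute)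

text \<open>The factors \<open>w a i\<close> for \<open>i \<in> I\<close> that are missing in \<open>HL_sum\<close> over \<open>S - I\<close> are
  exactly those that the operator supplies, so that the operator commutes with the recursion.\<close>

lemma sum_subsets_HL_sum:
  fixes w :: "'i \<Rightarrow> 'i \<Rightarrow> 'k::comm_ring_1"
  assumes "finite S"
    and "\<And>T. T \<subseteq> S \<Longrightarrow> card T = card S - length gs \<Longrightarrow>
      (\<Sum>I | I \<subseteq> T \<and> card I = r. \<Prod>i\<in>I. \<Prod>j\<in>T-I. w j i) = c"
  shows "(\<Sum>I | I \<subseteq> S \<and> card I = r. (\<Prod>i\<in>I. \<Prod>j\<in>S-I. w j i) * HL_sum w gs (S - I)) = c * HL_sum w gs S"
  using assms
proof (induction gs arbitrary: S)
  case Nil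
  then show ?case by simp
next
  case (Cons g gs)
  let ?A = "{I. I \<subseteq> S \<and> card I = r}"
  let ?X = "\<lambda>I a. (\<Prod>i\<in>I. \<Prod>j\<in>S-I. w j i) * (g a * (\<Prod>j\<in>S-I-{a}. w a j) * HL_sum w gs (S - I - {a}))"
  have "(\<Sum>I\<in>?A. (\<Prod>i\<in>I. \<Prod>j\<in>S-I. w j i) * HL_sum w (g # gs) (S - I))
      = (\<Sum>I\<in>?A. \<Sum>a | a \<in> S \<and> a \<notin> I. ?X I a)"
    by (simp add: sum_distrib_left set_diff_eq)
  \<comment> \<open>Once the first chosen element \<open>a\<close> is fixed, \<open>I\<close> ranges
    over subsets of \<open>S - {a}\<close>, and the induction hypothesis applies to that
    set.\<close>
  also have "\<dots> = (\<Sum>a\<in>S. \<Sum>I | I \<in> ?A \<and> a \<notin> I. ?X I a)"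
    by (rule sum.swap_restrict) (use Cons.prems finite_subsets_card in auto)
  also have "\<dots> = (\<Sum>a\<in>S. g a * (\<Prod>j\<in>S-{a}. w a j) * (c * HL_sum w gs (S - {a})))"
  proof (rule sum.cong[OF refl])
    fix a assume a: "a \<in> S"
    have set_eq: "{I \<in> ?A. a \<notin> I} = {I. I \<subseteq> S - {a} \<and> card I = r}"
      by auto
    have "?X I a = g a * (\<Prod>j\<in>S-{a}. w a j) *
        ((\<Prod>i\<in>I. \<Prod>j\<in>S-{a}-I. w j i) * HL_sum w gs (S - {a} - I))" if I: "I \<subseteq> S - {a}" for I
    proof -
      have [simp]: "S - I - {a} = S - {a} - I" by auto
      have "(\<Prod>j\<in>S-I. w j i) = w a i * (\<Prod>j\<in>S-{a}-I. w j i)" for i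
        using prod.remove[of "S - I" a "\<lambda>j. w j i"] I a Cons.prems(1) by auto
      then have "(\<Prod>i\<in>I. \<Prod>j\<in>S-I. w j i) = (\<Prod>i\<in>I. w a i) * (\<Prod>i\<in>I. \<Prod>j\<in>S-{a}-I. w j i)"
        by (simp add: prod.distrib)
      moreover have "(\<Prod>j\<in>S-{a}. w a j) = (\<Prod>j\<in>I. w a j) * (\<Prod>j\<in>S-{a}-I. w a j)"
        using I Cons.prems(1) by (intro prod_subset_complement) auto
      ultimately show ?thesis by (simp add: algebra_simps)
    qed
    then have "(\<Sum>I | I \<in> ?A \<and> a \<notin> I. ?X I a) = g a * (\<Prod>j\<in>S-{a}. w a j) *
        (\<Sum>I | I \<subseteq> S - {a} \<and> card I = r. (\<Prod>i\<in>I. \<Prod>j\<in>S-{a}-I. w j i) * HL_sum w gs (S - {a} - I))"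
      unfolding set_eq sum_distrib_left by (intro sum.cong) auto
    also have "(\<Sum>I | I \<subseteq> S - {a} \<and> card I = r. (\<Prod>i\<in>I. \<Prod>j\<in>S-{a}-I. w j i) * HL_sum w gs (S - {a} - I))
        = c * HL_sum w gs (S - {a})"
    proof (rule Cons.IH)
      fix T assume "T \<subseteq> S - {a}" "card T = card (S - {a}) - length gs"
      then show "(\<Sum>I | I \<subseteq> T \<and> card I = r. \<Prod>i\<in>I. \<Prod>j\<in>T-I. w j i) = c"
        using Cons.prems a by (intro Cons.prems(2)) auto
    qed (use Cons.prems in auto)
    finally show "(\<Sum>I | I \<in> ?A \<and> a \<notin> I. ?X I a) =
        g a * (\<Prod>j\<in>S-{a}. w a j) * (c * HL_sum w gs (S - {a}))" .
  qed
  finally show ?case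
    by (simp add: sum_distrib_left algebra_simps)
qed

text \<open>Both are \<open>sum_prod_ratio\<close>, at \<open>(a, b) = (1, q)\<close> and at
  \<open>(q, 1)\<close>: swapping the arguments of the weight exchanges the two
  coefficients.\<close>

lemma sum_HL_weight:
  fixes u :: "'i \<Rightarrow> 'k::field"
  assumes "finite S" "inj_on u S" "\<And>i. i \<in> S \<Longrightarrow> u i \<noteq> 0"
  shows "(1 - q) * (\<Sum>a\<in>S. \<Prod>b\<in>S-{a}. HL_weight q u a b) = 1 - q ^ card S"
    and "(1 - q) * (\<Sum>a\<in>S. \<Prod>b\<in>S-{a}. HL_weight q u b a) = 1 - q ^ card S"
proof -
  show "(1 - q) * (\<Sum>a\<in>S. \<Prod>b\<in>S-{a}. HL_weight q u a b) = 1 - q ^ card S"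
    using sum_prod_ratio[OF assms, of 1 q] by (simp add: HL_weight_def)
  have w: "HL_weight q u b a = (q * u a - 1 * u b) / (u a - u b)" for a b
    using minus_divide_divide[of "u b - q * u a" "u b - u a"] by (simp add: HL_weight_def)
  have "(q - 1) * (\<Sum>a\<in>S. \<Prod>b\<in>S-{a}. HL_weight q u b a) = q ^ card S - 1"
    unfolding w using sum_prod_ratio[OF assms, of q 1] by simp
  then show "(1 - q) * (\<Sum>a\<in>S. \<Prod>b\<in>S-{a}. HL_weight q u b a) = 1 - q ^ card S"
    by (simp add: algebra_simps)
qed

text \<open>Marking an element of \<open>I\<close> and removing it lowers \<open>r\<close>; the marks contribute
  \<open>(1 - q ^ r) / (1 - q)\<close>.\<close>

lemma sum_subsets_HL_weight:
  fixes u :: "'i \<Rightarrow> 'k::field"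
  assumes "finite S" "inj_on u S" "\<And>i. i \<in> S \<Longrightarrow> u i \<noteq> 0" "\<And>j. j > 0 \<Longrightarrow> q ^ j \<noteq> 1"
  shows "q ^ (r choose 2) * (\<Sum>I | I \<subseteq> S \<and> card I = r. \<Prod>i\<in>I. \<Prod>j\<in>S-I. HL_weight q u j i) =
    elem_sym_geom q r (card S)"
  using assms
proof (induction r arbitrary: S)
  case 0
  then have "{I. I \<subseteq> S \<and> card I = 0} = {{}}"
    by (auto dest: finite_subset)
  then show ?case by (simp only: elem_sym_0) (simp add: binomial_eq_0)
next
  case (Suc r)
  let ?w = "HL_weight q u"
  let ?A = "{I. I \<subseteq> S \<and> card I = Suc r}"
  let ?A' = "\<lambda>a. {I. I \<subseteq> S - {a} \<and> card I = r}"
  let ?B = "\<Sum>I\<in>?A. \<Prod>i\<in>I. \<Prod>j\<in>S-I. ?w j i"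
  show ?case
  proof (cases "card S")
    case 0
    then have "?A = {}"
      using Suc.prems by auto
    then show ?thesis
      unfolding 0 by (simp only: sum.empty mult_zero_right elem_sym_Suc_0)
  next
    case (Suc m)
    let ?Y = "\<lambda>I a. (\<Prod>i\<in>I. \<Prod>j\<in>S-I. ?w j i) * (\<Prod>b\<in>I-{a}. ?w b a)"
    have "(1 - q ^ Suc r) * ?B = (\<Sum>I\<in>?A. (\<Prod>i\<in>I. \<Prod>j\<in>S-I. ?w j i) * (1 - q ^ card I))"
      unfolding sum_distrib_left by (intro sum.cong) (auto simp: mult.commute)
    also have "\<dots> = (\<Sum>I\<in>?A. (\<Prod>i\<in>I. \<Prod>j\<in>S-I. ?w j i) * ((1 - q) * (\<Sum>a\<in>I. \<Prod>b\<in>I-{a}. ?w b a)))"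
    proof (intro sum.cong refl)
      fix I assume "I \<in> ?A"
      then have "finite I" "inj_on u I" "\<And>i. i \<in> I \<Longrightarrow> u i \<noteq> 0"
        using Suc.prems by (auto intro: finite_subset inj_on_subset)
      from sum_HL_weight(2)[OF this, of q]
      show "(\<Prod>i\<in>I. \<Prod>j\<in>S-I. ?w j i) * (1 - q ^ card I) =
        (\<Prod>i\<in>I. \<Prod>j\<in>S-I. ?w j i) * ((1 - q) * (\<Sum>a\<in>I. \<Prod>b\<in>I-{a}. ?w b a))"
        by simp
    qed
    also have "\<dots> = (1 - q) * (\<Sum>I\<in>?A. \<Sum>a\<in>I. ?Y I a)"
      by (simp add: sum_distrib_left mult_ac)
    also have "(\<Sum>I\<in>?A. \<Sum>a\<in>I. ?Y I a) = (\<Sum>I\<in>?A. \<Sum>a | a \<in> S \<and> a \<in> I. ?Y I a)"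
      by (intro sum.cong refl) auto
    also have "\<dots> = (\<Sum>a\<in>S. \<Sum>I | I \<in> ?A \<and> a \<in> I. ?Y I a)"
      by (rule sum.swap_restrict) (use Suc.prems finite_subsets_card in auto)
    also have "\<dots> = (\<Sum>a\<in>S. (\<Prod>j\<in>S-{a}. ?w j a) * (\<Sum>I\<in>?A' a. \<Prod>i\<in>I. \<Prod>j\<in>S-{a}-I. ?w j i))"
    proof (rule sum.cong[OF refl])
      fix a assume a: "a \<in> S"
      have notin: "a \<notin> I" if "I \<in> ?A' a" for I
        using that by auto
      have fin: "finite I" if "I \<in> ?A' a" for I
        using that Suc.prems(1) by (auto intro: finite_subset)
      have "{I \<in> ?A. a \<in> I} = insert a ` ?A' a" (is "?L = ?R")
      proof (intro equalityI subsetI)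
        fix I assume I: "I \<in> ?L"
        then have "finite I" using Suc.prems(1) by (auto intro: finite_subset)
        with I have "I = insert a (I - {a})" "I - {a} \<in> ?A' a"
          by auto
        then show "I \<in> ?R" by blast
      next
        fix I assume "I \<in> ?R"
        then obtain I' where "I' \<in> ?A' a" "I = insert a I'"
          by blast
        with a fin[of I'] notin[of I'] show "I \<in> ?L"
          by auto
      qed
      moreover have "inj_on (insert a) (?A' a)"
        by (intro inj_onI) (metis notin insert_ident)
      ultimately have "(\<Sum>I | I \<in> ?A \<and> a \<in> I. ?Y I a) = (\<Sum>I\<in>?A' a. ?Y (insert a I) a)"
        by (simp add: sum.reindex)
      \<comment> \<open>The weights at the marked \<open>a\<close> coming from the complement of the
        subset and from its other elements combine to a product over \<open>S - {a}\<close>,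
        independent of \<open>I\<close>.\<close>
      also have "\<dots> = (\<Sum>I\<in>?A' a. (\<Prod>j\<in>S-{a}. ?w j a) * (\<Prod>i\<in>I. \<Prod>j\<in>S-{a}-I. ?w j i))"
      proof (rule sum.cong[OF refl])
        fix I assume I: "I \<in> ?A' a"
        have "S - insert a I = S - {a} - I" "insert a I - {a} = I"
          using notin[OF I] by auto
        moreover have "(\<Prod>j\<in>S-{a}. ?w j a) = (\<Prod>j\<in>I. ?w j a) * (\<Prod>j\<in>S-{a}-I. ?w j a)"
          using I Suc.prems(1) by (intro prod_subset_complement) auto
        ultimately show "?Y (insert a I) a = (\<Prod>j\<in>S-{a}. ?w j a) * (\<Prod>i\<in>I. \<Prod>j\<in>S-{a}-I. ?w j i)"
          using notin[OF I] fin[OF I] by simp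
      qed
      finally show "(\<Sum>I | I \<in> ?A \<and> a \<in> I. ?Y I a) =
        (\<Prod>j\<in>S-{a}. ?w j a) * (\<Sum>I\<in>?A' a. \<Prod>i\<in>I. \<Prod>j\<in>S-{a}-I. ?w j i)"
        by (simp add: sum_distrib_left)
    qed
    finally have "(1 - q ^ Suc r) * ?B = (1 - q) *
      (\<Sum>a\<in>S. (\<Prod>j\<in>S-{a}. ?w j a) * (\<Sum>I\<in>?A' a. \<Prod>i\<in>I. \<Prod>j\<in>S-{a}-I. ?w j i))" .
    then have "q ^ (r choose 2) * ((1 - q ^ Suc r) * ?B) = (1 - q) *
      (\<Sum>a\<in>S. (\<Prod>j\<in>S-{a}. ?w j a) * (q ^ (r choose 2) * (\<Sum>I\<in>?A' a. \<Prod>i\<in>I. \<Prod>j\<in>S-{a}-I. ?w j i)))"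
      by (simp add: sum_distrib_left mult.left_commute)
    also have "\<dots> = (1 - q) * (\<Sum>a\<in>S. (\<Prod>j\<in>S-{a}. ?w j a) * elem_sym_geom q r m)"
    proof -
      have "q ^ (r choose 2) * (\<Sum>I\<in>?A' a. \<Prod>i\<in>I. \<Prod>j\<in>S-{a}-I. ?w j i) = elem_sym_geom q r m"
        if a: "a \<in> S" for a
        using Suc.IH[of "S - {a}"] Suc.prems a Suc by (auto simp: inj_on_diff)
      then show ?thesis by simp
    qed
    also have "\<dots> = ((1 - q) * (\<Sum>a\<in>S. \<Prod>j\<in>S-{a}. ?w j a)) * elem_sym_geom q r m"
      by (simp add: sum_distrib_right mult.assoc)
    also have "\<dots> = (1 - q ^ Suc m) * elem_sym_geom q r m"
      using sum_HL_weight(2)[OF Suc.prems(1-3), of q] Suc by simp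
    \<comment> \<open>\<open>Suc r choose 2\<close> is \<open>(r choose 2) + r\<close>, the source
      of the factor \<open>q ^ r\<close>.\<close>
    finally have "(1 - q ^ Suc r) * (q ^ (Suc r choose 2) * ?B) = q ^ r * (1 - q ^ Suc m) * elem_sym_geom q r m"
      by (simp add: numeral_2_eq_2 power_add mult_ac)
    also have "\<dots> = (1 - q ^ Suc r) * elem_sym_geom q (Suc r) (card S)"
      using elem_sym_geom_Suc_Suc[of q r m] Suc by simp
    finally have "(1 - q ^ Suc r) * (q ^ (Suc r choose 2) * ?B) =
      (1 - q ^ Suc r) * elem_sym_geom q (Suc r) (card S)" .
    moreover have "1 - q ^ Suc r \<noteq> 0"
      using Suc.prems(4)[of "Suc r"] by (simp del: power_Suc)
    ultimately show ?thesis
      using mult_left_cancel by blast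
  qed
qed

text \<open>With \<open>k\<close> elements left, choosing the next one contributes
  \<open>(1 - q ^ k) / (1 - q)\<close> by \<open>sum_HL_weight\<close>. The last \<open>m\<close>
  choices thus give \<open>qpoch q q m / (1 - q) ^ m\<close>, which the prefactor of
  \<open>spin_HL\<close> compensates.\<close>

lemma HL_sum_append_ones:
  fixes u :: "'i \<Rightarrow> 'k::field"
  assumes "finite S" "inj_on u S" "\<And>i. i \<in> S \<Longrightarrow> u i \<noteq> 0" "card S = length gs + m"
  shows "(1 - q) ^ m * HL_sum (HL_weight q u) (gs @ replicate m (\<lambda>_. 1)) S =
    qpoch q q m * HL_sum (HL_weight q u) gs S"
  using assms
proof (induction gs arbitrary: S)
  case Nil
  then show ?case
  proof (induction m arbitrary: S)
    case (Suc m)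
    let ?w = "HL_weight q u"
    have IH: "(1 - q) ^ m * HL_sum ?w (replicate m (\<lambda>_. 1)) (S - {a}) = qpoch q q m" if "a \<in> S" for a
      using Suc.IH[of "S - {a}"] Suc.prems that by (auto simp: inj_on_diff)
    have "(1 - q) ^ Suc m * HL_sum ?w (replicate (Suc m) (\<lambda>_. 1)) S =
      (1 - q) * (\<Sum>a\<in>S. (\<Prod>j\<in>S-{a}. ?w a j) * ((1 - q) ^ m * HL_sum ?w (replicate m (\<lambda>_. 1)) (S - {a})))"
      by (simp add: sum_distrib_left mult_ac)
    also have "\<dots> = (1 - q) * (\<Sum>a\<in>S. (\<Prod>j\<in>S-{a}. ?w a j)) * qpoch q q m"
      using IH by (simp add: sum_distrib_right mult.assoc)
    also have "\<dots> = qpoch q q (Suc m)"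
      using sum_HL_weight(1)[OF Suc.prems(1-3), of q] Suc.prems(4) by (simp add: qpoch_Suc)
    finally show ?case by simp
  qed simp
next
  case (Cons g gs)
  let ?w = "HL_weight q u"
  have IH: "(1 - q) ^ m * HL_sum ?w (gs @ replicate m (\<lambda>_. 1)) (S - {a}) =
      qpoch q q m * HL_sum ?w gs (S - {a})" if "a \<in> S" for a
    using Cons.IH[of "S - {a}"] Cons.prems that by (auto simp: inj_on_diff)
  have "(1 - q) ^ m * HL_sum ?w ((g # gs) @ replicate m (\<lambda>_. 1)) S =
      (\<Sum>a\<in>S. g a * (\<Prod>j\<in>S-{a}. ?w a j) * ((1 - q) ^ m * HL_sum ?w (gs @ replicate m (\<lambda>_. 1)) (S - {a})))"
    by (simp add: sum_distrib_left mult_ac)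
  also have "\<dots> = qpoch q q m * HL_sum ?w (g # gs) S"
    using IH by (simp add: sum_distrib_left mult_ac)
  finally show ?case .
qed


section \<open>Ordered sums as sums over permutations\<close>

text \<open>An explicit list, so that distinctness and the absence of reversed pairs can be stated;
  both are needed to split off differences of variables one by one.\<close>

fun pairs :: "'a list \<Rightarrow> ('a \<times> 'a) list" where
  "pairs [] = []"
| "pairs (x # xs) = map (Pair x) xs @ pairs xs"

definition pair_prod :: "('a \<Rightarrow> 'a \<Rightarrow> 'b::comm_monoid_mult) \<Rightarrow> 'a list \<Rightarrow> 'b" where
  "pair_prod f xs = prod_list (map (\<lambda>(x, y). f x y) (pairs xs))"

lemma pair_prod_Nil [simp]: "pair_prod f [] = 1"
  by (simp add: pair_prod_def)

lemma pair_prod_Cons [simp]: "pair_prod f (x # xs) = prod_list (map (f x) xs) * pair_prod f xs"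
  by (simp add: pair_prod_def comp_def)

lemma pair_prod_map: "pair_prod f (map g xs) = pair_prod (\<lambda>x y. f (g x) (g y)) xs"
  by (induction xs) (simp_all add: comp_def)

lemma pairs_subset: "p \<in> set (pairs xs) \<Longrightarrow> fst p \<in> set xs \<and> snd p \<in> set xs"
  by (induction xs) auto

lemma pairs_antisym:
  "distinct xs \<Longrightarrow> (a, b) \<in> set (pairs xs) \<Longrightarrow> a \<noteq> b \<and> (b, a) \<notin> set (pairs xs)"
  by (induction xs) (auto dest: pairs_subset)

lemma distinct_pairs: "distinct xs \<Longrightarrow> distinct (pairs xs)"
  by (induction xs) (auto simp: distinct_map inj_on_def dest: pairs_subset)

section \<open>Products over pairs under reordering\<close>

definition cross_prod :: "('a \<Rightarrow> 'a \<Rightarrow> 'b::comm_monoid_mult) \<Rightarrow> 'a list \<Rightarrow> 'a list \<Rightarrow> 'b" where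
  "cross_prod f xs ys = prod_list (map (\<lambda>x. prod_list (map (f x) ys)) xs)"

lemma cross_prod_Nil [simp]: "cross_prod f [] ys = 1"
  by (simp add: cross_prod_def)

lemma cross_prod_Cons [simp]:
  "cross_prod f (x # xs) ys = prod_list (map (f x) ys) * cross_prod f xs ys"
  by (simp add: cross_prod_def)

lemma cross_prod_Cons_right [simp]:
  "cross_prod f xs (y # ys) = prod_list (map (\<lambda>x. f x y) xs) * cross_prod f xs ys"
  by (induction xs) (simp_all add: mult_ac)

lemma cross_prod_append_right [simp]:
  "cross_prod f xs (ys @ zs) = cross_prod f xs ys * cross_prod f xs zs"
  by (induction xs) (simp_all add: mult_ac)

lemma pair_prod_append: "pair_prod f (xs @ ys) = pair_prod f xs * pair_prod f ys * cross_prod f xs ys"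
  by (induction xs) (simp_all add: mult_ac)

text \<open>An entry \<open>y\<close> between the two positions contributes
  \<open>f l y * f y k\<close>, where the exchange changes two signs; only the factor of the
  exchanged entries themselves changes one.\<close>

lemma pair_prod_swap:
  fixes f :: "'a \<Rightarrow> 'a \<Rightarrow> 'b::comm_ring_1"
  assumes "\<And>x y. f y x = - f x y"
  shows "pair_prod f (xs @ l # ys @ k # zs) = - pair_prod f (xs @ k # ys @ l # zs)"
proof -
  have *: "prod_list (map (f l) ys) * prod_list (map (\<lambda>y. f y k) ys) =
      prod_list (map (f k) ys) * prod_list (map (\<lambda>y. f y l) ys)"
  proof (induction ys)
    case (Cons y ys)
    have "f l y * f y k = f k y * f y l"
      using assms[of l y] assms[of k y] by simp
    then have "(f l y * f y k) * (prod_list (map (f l) ys) * prod_list (map (\<lambda>y. f y k) ys)) =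
        (f k y * f y l) * (prod_list (map (f k) ys) * prod_list (map (\<lambda>y. f y l) ys))"
      using Cons by simp
    then show ?case
      by (simp add: mult_ac)
  qed simp
  \<comment> \<open>\<open>R a b\<close> collects the factors that are visibly symmetric in the two
    exchanged entries.\<close>
  define R where "R a b = pair_prod f xs * pair_prod f ys * pair_prod f zs * cross_prod f ys zs *
       cross_prod f xs ys * cross_prod f xs zs *
       (prod_list (map (f a) zs) * prod_list (map (f b) zs)) *
       (prod_list (map (\<lambda>x. f x a) xs) * prod_list (map (\<lambda>x. f x b) xs))" for a b
  have R: "R l k = R k l"
    by (simp add: R_def mult_ac)
  have expand: "pair_prod f (xs @ a # ys @ b # zs) =
     f a b * (prod_list (map (f a) ys) * prod_list (map (\<lambda>y. f y b) ys)) * R a b" for a b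
    by (simp add: R_def pair_prod_append mult_ac)
  show ?thesis
    unfolding expand * R assms[of k l] by simp
qed

text \<open>As the entries are distinct, transposing values exchanges exactly two positions, so
  \<open>pair_prod_swap\<close> applies.\<close>

lemma pair_prod_transpose:
  fixes f :: "'a \<Rightarrow> 'a \<Rightarrow> 'b::comm_ring_1"
  assumes antisym: "\<And>x y. f y x = - f x y"
    and "distinct xs" "k \<in> set xs" "l \<in> set xs" "k \<noteq> l"
  shows "pair_prod f (map (transpose k l) xs) = - pair_prod f xs"
proof -
  have *: "pair_prod f (map (transpose k l) xs) = - pair_prod f xs"
    if xs: "xs = as @ k # bs" and l: "l \<in> set bs" and kl: "k \<noteq> l" for as bs k l
  proof -
    obtain cs ds where "bs = cs @ l # ds"
      using l by (meson split_list)
    then have xs': "xs = as @ k # cs @ l # ds" using xs by simp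
    have fixed: "map (transpose k l) ys = ys" if "k \<notin> set ys" "l \<notin> set ys" for ys
      using that by (induction ys) (auto simp: transpose_def)
    have "map (transpose k l) xs = as @ l # cs @ k # ds"
      using assms(2) by (simp add: xs' fixed)
    then show ?thesis
      unfolding xs' by (simp only: pair_prod_swap[of f as l cs k ds, OF antisym])
  qed
  obtain as bs where xs: "xs = as @ k # bs"
    using assms(3) by (meson split_list)
  show ?thesis
  proof (cases "l \<in> set bs")
    case True
    then show ?thesis by (rule *[OF xs _ assms(5)])
  next
    case False
    then have "l \<in> set as" using assms(4,5) xs by auto
    then obtain cs ds where "as = cs @ l # ds"
      by (meson split_list)
    then have "xs = cs @ l # (ds @ k # bs)" "k \<in> set (ds @ k # bs)" using xs by auto
    from *[OF this assms(5)[symmetric]] show ?thesis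
      by (simp only: transpose_commute)
  qed
qed

text \<open>Reordering changes the product only by a sign. Recording divisibility avoids defining
  signs of orderings; the quotient takes their place in \<open>regular_HL_sum\<close>.\<close>

lemma pair_prod_dvd:
  fixes f :: "'a \<Rightarrow> 'a \<Rightarrow> 'b::comm_ring_1"
  assumes antisym: "\<And>x y. f y x = - f x y" and "mset xs = mset ys"
  shows "pair_prod f xs dvd pair_prod f ys"
  using assms(2)
proof (induction xs arbitrary: ys)
  case (Cons x xs)
  then obtain as bs where ys: "ys = as @ x # bs"
    by (metis list.set_intros(1) mset_eq_setD split_list)
  with Cons.prems have mset: "mset xs = mset (as @ bs)"
    by simp
  \<comment> \<open>Bringing \<open>x\<close> to the front reverses its pairs with
    \<open>as\<close>, which costs only signs.\<close>
  have flip: "prod_list (map (f x) as) dvd prod_list (map (\<lambda>y. f y x) as)"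
  proof (induction as)
    case (Cons a as)
    have "f x a dvd f a x" using antisym[of a x] by simp
    then show ?case using Cons by (simp add: mult_dvd_mono)
  qed simp
  have "prod_list (map (f x) xs) = prod_list (map (f x) as) * prod_list (map (f x) bs)"
    using mset by (metis map_append mset_map prod_list.append prod_mset_prod_list)
  moreover have "pair_prod f ys = prod_list (map (\<lambda>y. f y x) as) * prod_list (map (f x) bs) * pair_prod f (as @ bs)"
    by (simp add: ys pair_prod_append mult_ac)
  ultimately show ?case
    using Cons.IH[OF mset] flip by (simp add: mult_dvd_mono)
qed simp

text \<open>With as many entries as elements nothing is left over: the choices are the orderings of
  \<open>S\<close>, and each element is weighted against all later ones.\<close>

lemma HL_sum_permutations:
  assumes "finite S" "card S = length gs"
  shows "HL_sum w gs S =
    (\<Sum>xs\<in>permutations_of_set S. pair_prod w xs * prod_list (map2 (\<lambda>g x. g x) gs xs))"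
  using assms
proof (induction gs arbitrary: S)
  case (Cons g gs)
  let ?t = "\<lambda>gs xs. pair_prod w xs * prod_list (map2 (\<lambda>g x. g x) gs xs)"
  have "S \<noteq> {}" using Cons.prems by auto
  then have "sum (?t (g # gs)) (permutations_of_set S) =
      sum (?t (g # gs)) (\<Union>a\<in>S. (#) a ` permutations_of_set (S - {a}))"
    by (simp add: permutations_of_set_nonempty)
  also have "\<dots> = (\<Sum>a\<in>S. sum (?t (g # gs)) ((#) a ` permutations_of_set (S - {a})))"
    using Cons.prems by (intro sum.UNION_disjoint) auto
  also have "\<dots> = (\<Sum>a\<in>S. \<Sum>xs\<in>permutations_of_set (S - {a}). ?t (g # gs) (a # xs))"
    by (simp add: sum.reindex)
  also have "\<dots> = (\<Sum>a\<in>S. \<Sum>xs\<in>permutations_of_set (S - {a}). g a * (\<Prod>j\<in>S-{a}. w a j) * ?t gs xs)"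
  proof (intro sum.cong refl)
    fix a xs assume "a \<in> S" "xs \<in> permutations_of_set (S - {a})"
    then have "prod_list (map (w a) xs) = (\<Prod>j\<in>S-{a}. w a j)"
      using permutations_of_setD[of xs "S - {a}"] prod.distinct_set_conv_list by metis
    then show "?t (g # gs) (a # xs) = g a * (\<Prod>j\<in>S-{a}. w a j) * ?t gs xs"
      by (simp add: mult_ac)
  qed
  also have "\<dots> = HL_sum w (g # gs) S"
    using Cons by (simp add: sum_distrib_left)
  finally show ?case ..
qed simp

lemma pair_prod_upt:
  "pair_prod f (map g [m..<n]) = (\<Prod>i\<in>{m..<n}. \<Prod>j\<in>{i<..<n}. f (g i) (g j))"
proof (induction "n - m" arbitrary: m)
  case (Suc d)
  then have "m < n" by simp
  moreover have "{m..<n} = insert m {Suc m..<n}" using \<open>m < n\<close> by auto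
  moreover have "{m<..<n} = {Suc m..<n}" by auto
  moreover have "prod_list (map (f (g m) \<circ> g) [Suc m..<n]) = (\<Prod>j\<in>{Suc m..<n}. f (g m) (g j))"
    using prod.distinct_set_conv_list[of "[Suc m..<n]" "\<lambda>j. f (g m) (g j)"] by (simp add: comp_def)
  ultimately show ?case
    using Suc by (simp add: upt_conv_Cons del: upt_Suc)
qed simp

lemma bij_betw_permutes_permutations_of_set:
  "bij_betw (\<lambda>\<sigma>. map \<sigma> [1..<Suc n]) {\<sigma>. \<sigma> permutes {1..n}} (permutations_of_set {1..n})"
proof -
  let ?F = "\<lambda>\<sigma>. map \<sigma> [1..<Suc n]"
  have inj: "inj_on ?F {\<sigma>. \<sigma> permutes {1..n}}"
  proof (rule inj_onI)
    fix \<sigma> \<tau> assume *: "\<sigma> \<in> {\<sigma>. \<sigma> permutes {1..n}}" "\<tau> \<in> {\<sigma>. \<sigma> permutes {1..n}}" "?F \<sigma> = ?F \<tau>"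
    then have "\<forall>i\<in>{1..n}. \<sigma> i = \<tau> i" by (auto simp del: upt_Suc)
    with * show "\<sigma> = \<tau>"
      by (metis mem_Collect_eq permutes_not_in ext)
  qed
  have "?F ` {\<sigma>. \<sigma> permutes {1..n}} \<subseteq> permutations_of_set {1..n}"
  proof clarify
    fix \<sigma> assume s: "\<sigma> permutes {1..n}"
    have "set [1..<Suc n] = {1..n}" by auto
    then show "?F \<sigma> \<in> permutations_of_set {1..n}"
      using permutes_image[OF s] permutes_inj_on[OF s]
      by (intro permutations_of_setI) (simp_all add: distinct_map del: upt_Suc)
  qed
  \<comment> \<open>Surjectivity by counting: both sets have \<open>fact n\<close> elements.\<close>
  moreover have "card (?F ` {\<sigma>. \<sigma> permutes {1..n}}) = card (permutations_of_set {1..n})"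
    using card_image[OF inj] by (simp add: card_permutations)
  ultimately have "?F ` {\<sigma>. \<sigma> permutes {1..n}} = permutations_of_set {1..n}"
    by (intro card_subset_eq) auto
  with inj show ?thesis by (simp add: bij_betw_def)
qed

lemma sum_permutes_eq_HL_sum:
  assumes "length gs = n"
  shows "(\<Sum>\<sigma> | \<sigma> permutes {1..n}. (\<Prod>i\<in>{1..n}. \<Prod>j\<in>{i<..n}. w (\<sigma> i) (\<sigma> j)) *
     (\<Prod>i\<in>{1..n}. (gs ! (i - 1)) (\<sigma> i))) = HL_sum w gs {1..n}"
proof -
  have "(\<Prod>i\<in>{1..n}. \<Prod>j\<in>{i<..n}. w (\<sigma> i) (\<sigma> j)) = pair_prod w (map \<sigma> [1..<Suc n])" for \<sigma>
    unfolding pair_prod_upt by (intro prod.cong) auto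
  moreover have "(\<Prod>i\<in>{1..n}. (gs ! (i - 1)) (\<sigma> i)) =
      prod_list (map2 (\<lambda>g x. g x) gs (map \<sigma> [1..<Suc n]))" for \<sigma>
  proof -
    have "prod_list (map2 (\<lambda>g x. g x) gs (map \<sigma> [1..<Suc n])) = (\<Prod>i\<in>{0..<n}. (gs ! i) (\<sigma> (Suc i)))"
      unfolding prod.list_conv_set_nth using assms by (intro prod.cong) (auto simp del: upt_Suc)
    \<comment> \<open>List positions start at 0, variable indices at 1.\<close>
    also have "\<dots> = (\<Prod>i\<in>{1..n}. (gs ! (i - 1)) (\<sigma> i))"
      by (rule prod.reindex_bij_witness[of _ "\<lambda>i. i - 1" Suc]) auto
    finally show ?thesis ..
  qed
  ultimately show ?thesis
    using assms sum.reindex_bij_betw[OF bij_betw_permutes_permutations_of_set[of n],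
        of "\<lambda>xs. pair_prod w xs * prod_list (map2 (\<lambda>g x. g x) gs xs)"]
    by (simp add: HL_sum_permutations del: upt_Suc)
qed


section \<open>Cancellation of the poles on the diagonals\<close>

lemma poly_const_hom:
  "poly_const (0::'a::idom) = 0" "poly_const (1::'a) = 1"
  "poly_const (a - b) = poly_const a - poly_const (b::'a)"
  "poly_const (a * b) = poly_const a * poly_const (b::'a)"
  by (simp_all add: poly_const_def single_diff mult_single)

lemma poly_subst_const [simp]: "poly_subst f (poly_const c) = poly_const c"
  by (simp add: poly_const_def poly_subst_single)

lemma poly_subst_1 [simp]: "poly_subst f (1::'a::idom mpoly) = 1"
  using poly_subst_const[of f "1::'a"] by (simp add: poly_const_hom)

lemma poly_subst_var [simp]: "poly_subst f (poly_var i) = f i"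
  by (simp add: poly_var_def poly_subst_single poly_const_hom)

lemma poly_subst_uminus [simp]: "poly_subst f (- p) = - poly_subst f p"
  using poly_subst_add[of f p "- p"] by (simp add: eq_neg_iff_add_eq_0 add.commute)

lemma poly_subst_diff [simp]: "poly_subst f (p - q) = poly_subst f p - poly_subst f q"
  using poly_subst_add[of f p "- q"] by simp

lemma poly_subst_power [simp]: "poly_subst f (p ^ n) = poly_subst f p ^ n"
  by (induction n) (simp_all add: poly_subst_mult)

lemma poly_subst_prod: "poly_subst f (prod g A) = (\<Prod>x\<in>A. poly_subst f (g x))"
  by (induction A rule: infinite_finite_induct) (simp_all add: poly_subst_mult)

lemma poly_subst_prod_list: "poly_subst f (prod_list ps) = prod_list (map (poly_subst f) ps)"
  by (induction ps) (simp_all add: poly_subst_mult)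

lemma poly_subst_pair_prod:
  "poly_subst f (pair_prod g xs) = pair_prod (\<lambda>x y. poly_subst f (g x y)) xs"
  by (induction xs) (simp_all add: poly_subst_mult poly_subst_prod_list comp_def)

lemma poly_subst_id: "poly_subst poly_var p = (p :: 'a::idom mpoly)"
proof -
  have mono: "(\<Prod>i\<in>A. poly_var i ^ Poly_Mapping.lookup m i) =
     (Poly_Mapping.single (\<Sum>i\<in>A. Poly_Mapping.single i (Poly_Mapping.lookup m i)) 1 :: 'a mpoly)"
    if "finite A" for m :: "nat \<Rightarrow>\<^sub>0 nat" and A
    using that
  proof (induction A)
    case (insert i A)
    have "poly_var i ^ n = (Poly_Mapping.single (Poly_Mapping.single i n) 1 :: 'a mpoly)" for n
      by (induction n) (simp_all add: poly_var_def mult_single flip: single_add)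
    with insert show ?case by (simp add: mult_single)
  qed simp
  have "(\<Sum>m\<in>Poly_Mapping.keys p. poly_const (Poly_Mapping.lookup p m) *
        (\<Prod>i\<in>Poly_Mapping.keys m. poly_var i ^ Poly_Mapping.lookup m i)) =
     (\<Sum>m\<in>Poly_Mapping.keys p. Poly_Mapping.single m (Poly_Mapping.lookup p m))"
  proof (rule sum.cong[OF refl])
    fix m :: "nat \<Rightarrow>\<^sub>0 nat"
    have "(\<Sum>i\<in>Poly_Mapping.keys m. Poly_Mapping.single i (Poly_Mapping.lookup m i)) = m"
      by (rule poly_mapping_eqI) (auto simp: lookup_sum lookup_single when_def sum.delta in_keys_iff)
    then show "poly_const (Poly_Mapping.lookup p m) *
        (\<Prod>i\<in>Poly_Mapping.keys m. poly_var i ^ Poly_Mapping.lookup m i) =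
      Poly_Mapping.single m (Poly_Mapping.lookup p m)"
      by (simp add: mono poly_const_def mult_single)
  qed
  then show ?thesis
    unfolding poly_subst_def using poly_eq_sum_single[of p] by simp
qed

section \<open>Divisibility by differences of variables\<close>

lemma dvd_diff_mult:
  fixes d :: "'a::comm_ring_1"
  assumes "d dvd a - b" "d dvd x - y"
  shows "d dvd a * x - b * y"
proof -
  have "a * x - b * y = (a - b) * x + b * (x - y)" by (simp add: algebra_simps)
  then show ?thesis using assms by simp
qed

text \<open>The substitutions are congruent modulo \<open>d\<close> on variables, hence on all sums
  of products of them.\<close>

lemma poly_subst_dvd_diff:
  assumes "\<And>i. d dvd f i - g i"
  shows "d dvd poly_subst f p - poly_subst g p"
proof -
  have power: "d dvd f i ^ n - g i ^ n" for i n
    by (induction n) (auto intro: dvd_diff_mult assms)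
  have "d dvd (\<Prod>i\<in>A. f i ^ n i) - (\<Prod>i\<in>A. g i ^ n i)" for A n
    by (induction A rule: infinite_finite_induct) (auto intro: dvd_diff_mult power)
  then have "d dvd c * (\<Prod>i\<in>A. f i ^ n i) - c * (\<Prod>i\<in>A. g i ^ n i)" for c A n
    by (intro dvd_diff_mult) auto
  then show ?thesis
    unfolding poly_subst_def by (simp only: sum_subtractf[symmetric] dvd_sum)
qed

text \<open>Restriction to the diagonal \<open>u_k = u_l\<close>, realised inside the same
  polynomial ring by replacing \<open>u_k\<close> with \<open>u_l\<close>.\<close>

definition poly_identify :: "nat \<Rightarrow> nat \<Rightarrow> 'a::idom mpoly \<Rightarrow> 'a mpoly" where
  "poly_identify k l = poly_subst (\<lambda>i. poly_var (if i = k then l else i))"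

lemma poly_var_eq_iff [simp]: "poly_var i = (poly_var j :: 'a::idom mpoly) \<longleftrightarrow> i = j"
proof
  assume "poly_var i = (poly_var j :: 'a mpoly)"
  from arg_cong[OF this, of Poly_Mapping.keys]
  have "Poly_Mapping.single i (1::nat) = Poly_Mapping.single j 1"
    by (simp add: poly_var_def)
  from arg_cong[OF this, of Poly_Mapping.keys] show "i = j"
    by simp
qed simp

text \<open>Factor theorem: identification and the identity substitution agree on variables modulo
  \<open>u_k - u_l\<close>, so a polynomial vanishing on the diagonal is divisible by this
  difference.\<close>

lemma poly_identify_dvd_diff: "poly_var k - poly_var l dvd p - poly_identify k l p"
proof -
  have "poly_var k - poly_var l dvd
    poly_subst poly_var p - poly_subst (\<lambda>i. poly_var (if i = k then l else i)) p"
    by (rule poly_subst_dvd_diff) simp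
  then show ?thesis
    by (simp only: poly_subst_id poly_identify_def)
qed

text \<open>Factors are split off one at a time. Those already split off do not vanish on
  \<open>u_k = u_l\<close>, so the cofactor does and is divisible by the next difference.\<close>

lemma prod_list_diff_dvd:
  fixes p :: "'a::idom mpoly"
  assumes "distinct qs" "\<And>a b. (a, b) \<in> set qs \<Longrightarrow> a \<noteq> b \<and> (b, a) \<notin> set qs \<and> poly_identify a b p = 0"
  shows "prod_list (map (\<lambda>(a, b). poly_var a - poly_var b) qs) dvd p"
  using assms
proof (induction qs)
  case (Cons q qs)
  obtain k l where q: "q = (k, l)" by fastforce
  let ?P = "prod_list (map (\<lambda>(a, b). poly_var a - poly_var b) qs) :: 'a mpoly"
  have "?P dvd p"
  proof (rule Cons.IH)
    fix a b assume "(a, b) \<in> set qs"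
    then have "(a, b) \<in> set (q # qs)" by simp
    from Cons.prems(2)[OF this] show "a \<noteq> b \<and> (b, a) \<notin> set qs \<and> poly_identify a b p = 0"
      by simp
  qed (use Cons.prems(1) in simp)
  then obtain p' where p: "p = ?P * p'" ..
  have kl: "k \<noteq> l" "(l, k) \<notin> set qs" "(k, l) \<notin> set qs" "poly_identify k l p = 0"
    using Cons.prems(1) Cons.prems(2)[of k l] by (simp_all add: q)
  \<comment> \<open>A difference of distinct variables vanishes under the identification only if it
    is \<open>u_k - u_l\<close> up to sign.\<close>
  have "poly_identify k l ?P \<noteq> 0"
  proof
    assume "poly_identify k l ?P = 0"
    then obtain a b where ab: "(a, b) \<in> set qs" and "poly_identify k l (poly_var a - poly_var b :: 'a mpoly) = 0"
      by (auto simp: poly_identify_def poly_subst_prod_list prod_list_zero_iff)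
    then have "(if a = k then l else a) = (if b = k then l else b)"
      by (simp add: poly_identify_def)
    moreover have "a \<noteq> b"
      using Cons.prems(2)[of a b] ab by simp
    ultimately have "(a, b) = (k, l) \<or> (a, b) = (l, k)"
      by (auto split: if_splits)
    then show False
      using ab kl(2,3) by blast
  qed
  moreover have "poly_identify k l ?P * poly_identify k l p' = 0"
    using kl(4) by (simp add: p poly_identify_def poly_subst_mult)
  ultimately have "poly_identify k l p' = 0"
    by simp
  then have "poly_var k - poly_var l dvd p'"
    using poly_identify_dvd_diff[of k l p'] by simp
  then show ?case
    by (simp add: p q mult_dvd_mono mult.commute[of "poly_var k - poly_var l"])
qed simp

definition vandermonde :: "nat list \<Rightarrow> 'a::idom mpoly" where
  "vandermonde = pair_prod (\<lambda>a b. poly_var a - poly_var b)"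

lemma vandermonde_nonzero: "distinct xs \<Longrightarrow> vandermonde xs \<noteq> 0"
  by (auto simp: vandermonde_def pair_prod_def prod_list_zero_iff dest: pairs_antisym)

lemma vandermonde_dvd:
  assumes "distinct xs" "\<And>k l. k \<in> set xs \<Longrightarrow> l \<in> set xs \<Longrightarrow> k \<noteq> l \<Longrightarrow> poly_identify k l p = 0"
  shows "vandermonde xs dvd p"
  unfolding vandermonde_def pair_prod_def using assms(1)
proof (intro prod_list_diff_dvd distinct_pairs)
  fix a b assume ab: "(a, b) \<in> set (pairs xs)"
  with assms(1) have "a \<noteq> b \<and> (b, a) \<notin> set (pairs xs)"
    by (rule pairs_antisym)
  moreover from pairs_subset[OF ab] have "a \<in> set xs" "b \<in> set xs"
    by simp_all
  ultimately show "a \<noteq> b \<and> (b, a) \<notin> set (pairs xs) \<and> poly_identify a b p = 0"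
    using assms(2) by simp
qed

section \<open>Common denominators and regularity\<close>

lemma Fract_prod_list:
  "prod_list (map (\<lambda>x. Fract (f x) (g x)) xs) = Fract (prod_list (map f xs)) (prod_list (map g xs))"
  by (induction xs) (simp_all add: One_fract_def)

lemma Fract_pair_prod:
  "pair_prod (\<lambda>x y. Fract (f x y) (g x y)) xs = Fract (pair_prod f xs) (pair_prod g xs)"
  by (induction xs) (simp_all add: One_fract_def Fract_prod_list)

lemma Fract_sum:
  assumes "d \<noteq> (0::'a::idom)"
  shows "(\<Sum>x\<in>A. Fract (f x) d) = Fract (\<Sum>x\<in>A. f x) d"
proof (induction A rule: infinite_finite_induct)
  case (insert x A)
  have "Fract (f x * d + sum f A * d) (d * d) = Fract (d * (f x + sum f A)) (d * d)"
    by (simp add: algebra_simps)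
  then show ?case
    using insert assms by (simp add: mult_fract_cancel)
qed (simp_all add: fract_collapse)

text \<open>The condition under which \<open>T0_Fract\<close> determines \<open>T0 I f\<close>: one
  denominator must survive setting all variables in \<open>I\<close> to zero at once.\<close>

definition regular_at_zero :: "nat set \<Rightarrow> 'a::idom ratfun \<Rightarrow> bool" where
  "regular_at_zero I f \<longleftrightarrow> (\<exists>p d. poly_set_zero I d \<noteq> 0 \<and> f = Fract p d)"

text \<open>Over the common denominator the numerator is alternating under the transpositions of
  variables, hence divisible by the Vandermonde product.\<close>

lemma regular_HL_sum:
  fixes ps :: "(nat \<Rightarrow> 'a::field_char_0 mpoly) list" and c :: 'a
  assumes S: "finite S" "card S = length ps"
    and d: "\<And>a. poly_set_zero I (d a) \<noteq> 0"
    and ps: "\<And>p k l a. p \<in> set ps \<Longrightarrow> k \<noteq> l \<Longrightarrow>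
      poly_identify k l (p (transpose k l a)) = poly_identify k l (p a)"
  shows "regular_at_zero I
    (HL_sum (HL_weight (rf_const c) rf_var) (map (\<lambda>p a. Fract (p a) (d a)) ps) S)"
proof -
  let ?w = "HL_weight (rf_const c) (rf_var :: nat \<Rightarrow> 'a ratfun)"
  let ?V = "vandermonde :: nat list \<Rightarrow> 'a mpoly"
  let ?num = "\<lambda>a b. poly_var a - poly_const c * poly_var b :: 'a mpoly"
  obtain xs0 where xs0: "set xs0 = S" "distinct xs0"
    using finite_distinct_list[OF S(1)] by auto
  define N where "N xs = pair_prod ?num xs * prod_list (map2 (\<lambda>p x. p x) ps xs)" for xs
  define D where "D = (\<Prod>x\<in>S. d x)"
  \<comment> \<open>The sign relating the ordering \<open>xs\<close> to the reference ordering
    \<open>xs0\<close>, obtained as a quotient of Vandermonde products.\<close>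
  define e where "e xs = (SOME e. ?V xs0 = ?V xs * e)" for xs
  have D: "poly_set_zero I D \<noteq> 0"
    using d S(1) by (simp add: D_def poly_set_zero_def poly_subst_prod)
  then have D0: "D \<noteq> 0"
    by (auto simp: poly_set_zero_def)
  have e: "?V xs0 = ?V xs * e xs" if "xs \<in> permutations_of_set S" for xs
  proof -
    have "mset xs = mset xs0"
      using permutations_of_setD[OF that] xs0 set_eq_iff_mset_eq_distinct by metis
    then have "?V xs dvd ?V xs0"
      unfolding vandermonde_def by (intro pair_prod_dvd) auto
    then show ?thesis
      unfolding e_def dvd_def by (rule someI_ex)
  qed
  have w: "?w = (\<lambda>a b. Fract (?num a b) (poly_var a - poly_var b))"
    by (intro ext) (simp add: HL_weight_def rf_const_def rf_var_def)
  have summand: "pair_prod ?w xs * prod_list (map2 (\<lambda>g x. g x) (map (\<lambda>p a. Fract (p a) (d a)) ps) xs) =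
      Fract (e xs * N xs) (?V xs0 * D)" if xs: "xs \<in> permutations_of_set S" for xs
  proof -
    have len: "length ps = length xs"
      using permutations_of_setD[OF xs] S(2) distinct_card by fastforce
    have "prod_list (map2 (\<lambda>g x. g x) (map (\<lambda>p a. Fract (p a) (d a)) ps) xs) =
        prod_list (map (\<lambda>(p, x). Fract (p x) (d x)) (zip ps xs))"
      by (simp add: zip_map1 comp_def case_prod_unfold)
    also have "\<dots> = Fract (prod_list (map2 (\<lambda>p x. p x) ps xs)) (prod_list (map (\<lambda>(p, x). d x) (zip ps xs)))"
      by (simp add: case_prod_unfold Fract_prod_list)
    also have "map (\<lambda>(p, x). d x) (zip ps xs) = map d (map snd (zip ps xs))"
      by (simp add: case_prod_unfold)
    also have "\<dots> = map d xs"
      using len by simp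
    also have "prod_list (map d xs) = D"
      using permutations_of_setD[OF xs] prod.distinct_set_conv_list[of xs d] by (simp add: D_def)
    finally have "pair_prod ?w xs * prod_list (map2 (\<lambda>g x. g x) (map (\<lambda>p a. Fract (p a) (d a)) ps) xs) =
        Fract (N xs) (?V xs * D)"
      by (simp add: w Fract_pair_prod N_def vandermonde_def)
    moreover have "e xs \<noteq> 0"
      using e[OF xs] vandermonde_nonzero[OF xs0(2), where 'a='a] by auto
    ultimately show ?thesis
      using mult_fract_cancel[of "e xs" "N xs" "?V xs * D"] e[OF xs] by (simp add: mult_ac)
  qed
  define M where "M = (\<Sum>xs\<in>permutations_of_set S. e xs * N xs)"
  have V0: "?V xs0 \<noteq> 0"
    by (rule vandermonde_nonzero[OF xs0(2)])
  have "?V xs0 dvd M"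
  proof (rule vandermonde_dvd[OF xs0(2)])
    fix k l assume kl: "k \<in> set xs0" "l \<in> set xs0" "k \<noteq> l"
    let ?t = "map (transpose k l)"
    let ?i = "poly_identify k l :: 'a mpoly \<Rightarrow> _"
    have perm: "?t xs \<in> permutations_of_set S" if "xs \<in> permutations_of_set S" for xs
    proof -
      have "transpose k l ` S = S"
        using kl xs0 by (auto simp: transpose_def image_iff)
      then show ?thesis
        using permutations_of_setD[OF that] by (intro permutations_of_setI) (auto simp: distinct_map)
    qed
    have e_t: "e (?t xs) = - e xs" if xs: "xs \<in> permutations_of_set S" for xs
    proof -
      have "?V (?t xs) = - ?V xs"
        unfolding vandermonde_def using kl xs0 permutations_of_setD[OF xs]
        by (intro pair_prod_transpose) auto
      then have "?V xs * e (?t xs) = ?V xs * (- e xs)"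
        using e[OF perm[OF xs]] e[OF xs] by simp
      then show ?thesis
        using vandermonde_nonzero[where 'a='a] permutations_of_setD[OF xs] mult_left_cancel by blast
    qed
    have i_var: "?i (poly_var (transpose k l a)) = ?i (poly_var a)" for a
      by (auto simp: poly_identify_def transpose_def)
    \<comment> \<open>Transposing entries exchanges two variables, which is invisible once they are
      identified.\<close>
    have N_t: "?i (N (?t xs)) = ?i (N xs)" for xs
    proof -
      have "?i (?num (transpose k l a) (transpose k l b)) = ?i (?num a b)" for a b
        using i_var[of a] i_var[of b] by (simp add: poly_identify_def poly_subst_mult)
      moreover have "prod_list (map ?i (map2 (\<lambda>p x. p x) ps (?t xs))) = prod_list (map ?i (map2 (\<lambda>p x. p x) ps xs))"
      proof (intro arg_cong[of _ _ prod_list] nth_equalityI)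
        fix j assume "j < length (map ?i (map2 (\<lambda>p x. p x) ps (?t xs)))"
        then have j: "j < length ps" "j < length xs" by auto
        from ps[OF nth_mem[OF j(1)] kl(3), of "xs ! j"] j
        show "map ?i (map2 (\<lambda>p x. p x) ps (?t xs)) ! j = map ?i (map2 (\<lambda>p x. p x) ps xs) ! j"
          by simp
      qed simp
      ultimately show ?thesis
        by (simp add: N_def poly_identify_def poly_subst_mult pair_prod_map poly_subst_pair_prod poly_subst_prod_list)
    qed
    have "?i M = (\<Sum>xs\<in>permutations_of_set S. ?i (e xs) * ?i (N xs))"
      by (simp add: M_def poly_identify_def poly_subst_sum poly_subst_mult)
    \<comment> \<open>The involution \<open>?t\<close> permutes the orderings and negates each
      \<open>e xs\<close>, so \<open>?i M\<close> is its own negative and vanishes in characteristic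
      0.\<close>
    also have "\<dots> = (\<Sum>xs\<in>permutations_of_set S. ?i (e (?t xs)) * ?i (N (?t xs)))"
      by (rule sum.reindex_bij_witness[of _ ?t ?t]) (auto simp: perm comp_def)
    also have "\<dots> = (\<Sum>xs\<in>permutations_of_set S. - (?i (e xs) * ?i (N xs)))"
      by (intro sum.cong refl) (simp add: e_t N_t, simp add: poly_identify_def)
    also have "\<dots> = - ?i M"
      by (simp add: M_def poly_identify_def poly_subst_sum poly_subst_mult sum_negf)
    finally have "?i M + ?i M = 0"
      by (simp only: eq_neg_iff_add_eq_0)
    then have "2 * ?i M = 0"
      by (simp only: mult_2)
    then show "?i M = 0"
      by simp
  qed
  then obtain M' where M': "M = ?V xs0 * M'" ..
  have "HL_sum ?w (map (\<lambda>p a. Fract (p a) (d a)) ps) S = (\<Sum>xs\<in>permutations_of_set S. Fract (e xs * N xs) (?V xs0 * D))"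
    using S by (subst HL_sum_permutations) (auto intro!: sum.cong simp: summand)
  also have "\<dots> = Fract M (?V xs0 * D)"
    using V0 D0 by (simp add: Fract_sum M_def)
  \<comment> \<open>All differences of variables have cancelled; \<open>D\<close> survives setting
    variables to zero.\<close>
  also have "\<dots> = Fract M' D"
    using V0 by (simp add: M' mult_fract_cancel)
  finally show ?thesis
    using D unfolding regular_at_zero_def by blast
qed


section \<open>Setting variables to zero\<close>

lemma poly_set_zero_hom [simp]:
  "poly_set_zero I 0 = 0" "poly_set_zero I (1::'a::idom mpoly) = 1"
  "poly_set_zero I (p - q) = poly_set_zero I p - poly_set_zero I (q::'a mpoly)"
  "poly_set_zero I (p + q) = poly_set_zero I p + poly_set_zero I (q::'a mpoly)"
  "poly_set_zero I (p * q) = poly_set_zero I p * poly_set_zero I (q::'a mpoly)"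
  "poly_set_zero I (p ^ n) = poly_set_zero I p ^ n"
  "poly_set_zero I (poly_const c) = poly_const c"
  "poly_set_zero I (poly_var i) = (if i \<in> I then 0 else poly_var i)"
  by (simp_all add: poly_set_zero_def poly_subst_mult poly_subst_add)

lemma poly_subst_poly_subst:
  "poly_subst f (poly_subst g p) = poly_subst (\<lambda>i. poly_subst f (g i)) p"
  unfolding poly_subst_def[of g] poly_subst_def[of "\<lambda>i. poly_subst f (g i)"]
  by (simp add: poly_subst_sum poly_subst_mult poly_subst_prod)

lemma poly_set_zero_insert: "poly_set_zero {i} (poly_set_zero I p) = poly_set_zero (insert i I) p"
  unfolding poly_set_zero_def poly_subst_poly_subst
  by (intro arg_cong[of _ _ "\<lambda>f. poly_subst f p"]) (auto simp: fun_eq_iff)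

lemma poly_set_zero_empty: "poly_set_zero {} p = p"
  using poly_subst_id by (simp add: poly_set_zero_def)

section \<open>Constants and variables as rational functions\<close>

lemma rf_const_hom:
  fixes a b :: "'a::field"
  shows "rf_const (1::'a) = 1" "rf_const (a - b) = rf_const a - rf_const b"
    "rf_const (a * b) = rf_const a * rf_const b" "rf_const (a / b) = rf_const a / rf_const b"
proof -
  show "rf_const (1::'a) = 1" "rf_const (a - b) = rf_const a - rf_const b"
    and mult: "rf_const (a * b) = rf_const a * rf_const b" for a b :: 'a
    by (simp_all add: rf_const_def poly_const_hom One_fract_def)
  have zero: "rf_const c = 0 \<longleftrightarrow> c = 0" for c :: 'a
  proof
    assume "rf_const c = 0"
    then have "poly_const c = 0"
      by (simp add: rf_const_def Zero_fract_def eq_fract)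
    then have "Poly_Mapping.lookup (poly_const c) 0 = 0"
      by simp
    then show "c = 0"
      by (simp add: poly_const_def)
  qed (simp add: rf_const_def poly_const_hom fract_collapse)
  show "rf_const (a / b) = rf_const a / rf_const b"
  \<comment> \<open>For \<open>b = 0\<close> both sides are 0 by the convention for
    division.\<close>
  proof (cases "b = 0")
    case False
    then have "rf_const (a / b) * rf_const b = rf_const a"
      by (simp flip: mult)
    then show ?thesis
      using zero[of b] False by (simp add: eq_divide_eq)
  qed (use zero[of 0] in simp)
qed

lemma rf_const_power: "rf_const (a ^ n :: 'a::field) = rf_const a ^ n"
  by (induction n) (simp_all add: rf_const_hom)

lemma rf_const_qpoch: "rf_const (qpoch a q n :: 'a::field) = qpoch (rf_const a) (rf_const q) n"
  by (induction n) (simp_all add: qpoch_def rf_const_hom rf_const_power)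

lemma poly_const_eq_iff [simp]: "poly_const a = poly_const b \<longleftrightarrow> a = b"
proof
  assume "poly_const a = poly_const b"
  from arg_cong[OF this, of "\<lambda>p. Poly_Mapping.lookup p 0"] show "a = b"
    by (simp add: poly_const_def)
qed simp

lemma rf_const_eq_iff [simp]: "rf_const a = rf_const b \<longleftrightarrow> a = b"
  by (simp add: rf_const_def eq_fract)

lemma rf_var_eq_iff [simp]: "rf_var i = rf_var j \<longleftrightarrow> i = j"
  by (simp add: rf_var_def eq_fract)

lemma poly_var_neq_const: "poly_var i \<noteq> poly_const c"
proof
  assume "poly_var i = poly_const c"
  from arg_cong[OF this, of "poly_subst (\<lambda>_. poly_const (c + 1))"] show False
    by simp
qed

lemma rf_var_nonzero [simp]: "rf_var i \<noteq> 0"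
  using poly_var_neq_const[of i 0] by (simp add: rf_var_def Zero_fract_def eq_fract poly_const_hom)

section \<open>The operator \<open>T0\<close> on regular functions\<close>

lemma T0_const [simp]: "T0 I (rf_const c) = rf_const c"
  and regular_const [simp]: "regular_at_zero I (rf_const c)"
proof -
  have "poly_set_zero I (1 :: 'a mpoly) \<noteq> 0" by simp
  then show "T0 I (rf_const c) = rf_const c"
    unfolding rf_const_def by (subst T0_Fract) auto
  show "regular_at_zero I (rf_const c)"
    unfolding rf_const_def regular_at_zero_def using \<open>poly_set_zero I 1 \<noteq> 0\<close> by blast
qed

lemma T0_mult:
  assumes "regular_at_zero I f" "regular_at_zero I g"
  shows "T0 I (f * g) = T0 I f * T0 I g" and "regular_at_zero I (f * g)"
proof -
  obtain p d p' d' where f: "f = Fract p d" "poly_set_zero I d \<noteq> 0"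
    and g: "g = Fract p' d'" "poly_set_zero I d' \<noteq> 0"
    using assms by (auto simp: regular_at_zero_def)
  then have nz: "poly_set_zero I (d * d') \<noteq> 0" by simp
  show "T0 I (f * g) = T0 I f * T0 I g"
    unfolding f(1) g(1) mult_fract T0_Fract[OF nz] T0_Fract[OF f(2)] T0_Fract[OF g(2)] by simp
  show "regular_at_zero I (f * g)"
    unfolding f(1) g(1) mult_fract regular_at_zero_def using nz by blast
qed

lemma T0_add:
  assumes "regular_at_zero I f" "regular_at_zero I g"
  shows "T0 I (f + g) = T0 I f + T0 I g" and "regular_at_zero I (f + g)"
proof -
  obtain p d p' d' where f: "f = Fract p d" "poly_set_zero I d \<noteq> 0"
    and g: "g = Fract p' d'" "poly_set_zero I d' \<noteq> 0"
    using assms by (auto simp: regular_at_zero_def)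
  have nz: "d \<noteq> 0" "d' \<noteq> 0" "poly_set_zero I (d * d') \<noteq> 0"
    using f g by auto
  then have *: "f + g = Fract (p * d' + p' * d) (d * d')"
    by (simp add: f g)
  show "T0 I (f + g) = T0 I f + T0 I g"
    unfolding * T0_Fract[OF nz(3)] using f g by (simp add: T0_Fract)
  show "regular_at_zero I (f + g)"
    unfolding * regular_at_zero_def using nz by blast
qed

lemma T0_zero [simp]: "T0 I 0 = 0" and regular_zero [simp]: "regular_at_zero I 0"
  using T0_const[of I 0] regular_const[of I 0]
  by (simp_all add: rf_const_def poly_const_hom fract_collapse)

lemma T0_one [simp]: "T0 I 1 = 1" and regular_one [simp]: "regular_at_zero I 1"
  using T0_const[of I 1] regular_const[of I 1]
  by (simp_all add: rf_const_def poly_const_hom fract_collapse)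

lemma T0_sum:
  assumes "\<And>x. x \<in> A \<Longrightarrow> regular_at_zero I (f x)"
  shows "T0 I (sum f A) = (\<Sum>x\<in>A. T0 I (f x)) \<and> regular_at_zero I (sum f A)"
  using assms by (induction A rule: infinite_finite_induct) (simp_all add: T0_add)

lemma T0_prod:
  assumes "\<And>x. x \<in> A \<Longrightarrow> regular_at_zero I (f x)"
  shows "T0 I (prod f A) = (\<Prod>x\<in>A. T0 I (f x)) \<and> regular_at_zero I (prod f A)"
  using assms by (induction A rule: infinite_finite_induct) (simp_all add: T0_mult)

lemma T0_empty: "T0 {} f = f"
proof (cases f)
  case (Fract p d)
  then show ?thesis
    by (simp add: T0_Fract poly_set_zero_empty)
qed

text \<open>Joint regularity matters: setting variables of \<open>u_1 / (u_1 + u_2)\<close> to zero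
  one by one gives 0 or 1, depending on the order. A denominator surviving the joint substitution
  survives each stage.\<close>

lemma T0_insert:
  assumes "regular_at_zero (insert i I) f"
  shows "T0 (insert i I) f = T0 {i} (T0 I f)" and "regular_at_zero I f"
proof -
  obtain p d where f: "f = Fract p d" and d: "poly_set_zero (insert i I) d \<noteq> 0"
    using assms by (auto simp: regular_at_zero_def)
  then have d': "poly_set_zero I d \<noteq> 0" "poly_set_zero {i} (poly_set_zero I d) \<noteq> 0"
    by (auto simp: poly_set_zero_insert dest: arg_cong[of _ _ "poly_set_zero {i}"])
  show "T0 (insert i I) f = T0 {i} (T0 I f)"
    unfolding f T0_Fract[OF d] T0_Fract[OF d'(1)] T0_Fract[OF d'(2)] poly_set_zero_insert ..
  show "regular_at_zero I f"
    using f d'(1) unfolding regular_at_zero_def by blast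
qed

text \<open>At most one of two distinct variables is set to zero, so the denominator survives. For
  \<open>b = i\<close> the value is \<open>u_a / u_a\<close>; for \<open>a = i\<close> it would be
  \<open>q\<close>, but such terms are killed in \<open>T0_HL_sum\<close>.\<close>

lemma T0_HL_weight:
  fixes c :: "'a::field"
  assumes "a \<noteq> b"
  shows "regular_at_zero {i} (HL_weight (rf_const c) rf_var a b)"
    and "a \<noteq> i \<Longrightarrow> T0 {i} (HL_weight (rf_const c) rf_var a b) =
      (if b = i then 1 else HL_weight (rf_const c) rf_var a b)"
proof -
  let ?d = "poly_var a - poly_var b :: 'a mpoly"
  have w: "HL_weight (rf_const c) rf_var a b = Fract (poly_var a - poly_const c * poly_var b) ?d"
    by (simp add: HL_weight_def rf_const_def rf_var_def)
  have nz: "poly_var j \<noteq> (0 :: 'a mpoly)" for j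
    using poly_var_neq_const[of j 0] by (simp add: poly_const_hom)
  then have d: "poly_set_zero {i} ?d \<noteq> 0"
    using assms by auto
  then show "regular_at_zero {i} (HL_weight (rf_const c) rf_var a b)"
    unfolding w regular_at_zero_def by blast
  show "T0 {i} (HL_weight (rf_const c) rf_var a b) =
      (if b = i then 1 else HL_weight (rf_const c) rf_var a b)" if "a \<noteq> i"
    unfolding w T0_Fract[OF d] using that nz by (auto simp: One_fract_def eq_fract)
qed

text \<open>Terms choosing \<open>i\<close> vanish through \<open>g\<close>, and in all others the
  weight against \<open>i\<close> becomes 1. Only one variable is treated at a time, because a
  weight need not be regular when both of its variables vanish.\<close>

lemma T0_HL_sum:
  fixes c :: "'a::field"
  assumes "finite S" "\<And>g a. g \<in> set gs \<Longrightarrow> regular_at_zero {i} (g a)"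
    and "\<And>g a. g \<in> set gs \<Longrightarrow> T0 {i} (g a) = (if a = i then 0 else g a)"
  shows "T0 {i} (HL_sum (HL_weight (rf_const c) rf_var) gs S) =
      HL_sum (HL_weight (rf_const c) rf_var) gs (S - {i}) \<and>
    regular_at_zero {i} (HL_sum (HL_weight (rf_const c) rf_var) gs S)"
  using assms
proof (induction gs arbitrary: S)
  case (Cons g gs)
  let ?w = "HL_weight (rf_const c) rf_var :: nat \<Rightarrow> nat \<Rightarrow> 'a ratfun"
  let ?H = "HL_sum ?w gs"
  have IH: "T0 {i} (?H S) = ?H (S - {i})" "regular_at_zero {i} (?H S)" if "finite S" for S
  proof -
    have "T0 {i} (?H S) = ?H (S - {i}) \<and> regular_at_zero {i} (?H S)"
    proof (rule Cons.IH[OF that])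
      fix h a assume "h \<in> set gs"
      then have "h \<in> set (g # gs)" by simp
      from Cons.prems(2)[OF this, of a] Cons.prems(3)[OF this, of a]
      show "regular_at_zero {i} (h a)" "T0 {i} (h a) = (if a = i then 0 else h a)" .
    qed
    then show "T0 {i} (?H S) = ?H (S - {i})" "regular_at_zero {i} (?H S)"
      by blast+
  qed
  have prod: "T0 {i} (\<Prod>j\<in>S-{a}. ?w a j) = (\<Prod>j\<in>S-{a}. T0 {i} (?w a j))"
    "regular_at_zero {i} (\<Prod>j\<in>S-{a}. ?w a j)" for a
  proof -
    have *: "regular_at_zero {i} (?w a x)" if "x \<in> S - {a}" for x
      using that by (intro T0_HL_weight(1)) auto
    show "T0 {i} (\<Prod>j\<in>S-{a}. ?w a j) = (\<Prod>j\<in>S-{a}. T0 {i} (?w a j))"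
      by (rule conjunct1[OF T0_prod[OF *]])
    show "regular_at_zero {i} (\<Prod>j\<in>S-{a}. ?w a j)"
      by (rule conjunct2[OF T0_prod[OF *]])
  qed
  have g: "regular_at_zero {i} (g a)" "T0 {i} (g a) = (if a = i then 0 else g a)" for a
    by (rule Cons.prems(2)[OF list.set_intros(1)], rule Cons.prems(3)[OF list.set_intros(1)])
  have summand: "T0 {i} (g a * (\<Prod>j\<in>S-{a}. ?w a j) * ?H (S - {a})) =
      T0 {i} (g a) * (\<Prod>j\<in>S-{a}. T0 {i} (?w a j)) * ?H (S - {a} - {i})"
    "regular_at_zero {i} (g a * (\<Prod>j\<in>S-{a}. ?w a j) * ?H (S - {a}))" for a
    using Cons.prems(1) by (simp_all add: T0_mult g(1) prod IH)
  have "T0 {i} (HL_sum ?w (g # gs) S) =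
      (\<Sum>a\<in>S. T0 {i} (g a) * (\<Prod>j\<in>S-{a}. T0 {i} (?w a j)) * ?H (S - {a} - {i}))"
    using T0_sum[where A = S, OF summand(2)] by (simp add: summand(1))
  also have "\<dots> = (\<Sum>a\<in>S-{i}. T0 {i} (g a) * (\<Prod>j\<in>S-{a}. T0 {i} (?w a j)) * ?H (S - {a} - {i}))"
    by (rule sum.mono_neutral_right) (use Cons.prems(1) in \<open>auto simp: g(2)\<close>)
  also have "\<dots> = (\<Sum>a\<in>S-{i}. g a * (\<Prod>j\<in>S-{i}-{a}. ?w a j) * ?H (S - {i} - {a}))"
  proof (rule sum.cong[OF refl])
    fix a assume a: "a \<in> S - {i}"
    have "(\<Prod>j\<in>S-{a}. T0 {i} (?w a j)) = (\<Prod>j\<in>S-{i}-{a}. ?w a j)"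
      using a Cons.prems(1) by (intro prod.mono_neutral_cong_right) (auto simp: T0_HL_weight(2))
    moreover have "S - {a} - {i} = S - {i} - {a}"
      by auto
    moreover have "T0 {i} (g a) = g a"
      using a g(2)[of a] by simp
    ultimately show "T0 {i} (g a) * (\<Prod>j\<in>S-{a}. T0 {i} (?w a j)) * ?H (S - {a} - {i}) =
        g a * (\<Prod>j\<in>S-{i}-{a}. ?w a j) * ?H (S - {i} - {a})"
      by (simp only:)
  qed
  also have "\<dots> = HL_sum ?w (g # gs) (S - {i})"
    by simp
  finally show ?case
    using T0_sum[where A = S, OF summand(2)] by simp
qed simp

section \<open>The factors attached to the parts of the diagram\<close>

definition spin_factor :: "'k::field \<Rightarrow> (nat \<Rightarrow> 'k) \<Rightarrow> nat \<Rightarrow> nat \<Rightarrow> 'k" where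
  "spin_factor s u l a = ((u a - s) / (1 - s * u a)) ^ l * (u a / (u a - s))"

text \<open>The two products over variables merge into one factor per position:
  \<open>spin_factor\<close> at the listed parts and 1 at the zero parts.\<close>

lemma spin_HL_eq_HL_sum:
  fixes u :: "nat \<Rightarrow> 'k::field"
  assumes "length lam \<le> n"
  shows "spin_HL q s lam n u = (1 - q) ^ n / qpoch q q (n - length lam) *
    HL_sum (HL_weight q u) (map (spin_factor s u) lam @ replicate (n - length lam) (\<lambda>_. 1)) {1..n}"
proof -
  define gs where "gs = map (spin_factor s u) lam @ replicate (n - length lam) (\<lambda>_. 1)"
  have "(\<Prod>i\<in>{1..n}. ((u (\<sigma> i) - s) / (1 - s * u (\<sigma> i))) ^ part lam i) *
      (\<Prod>i\<in>{1..length lam}. u (\<sigma> i) / (u (\<sigma> i) - s)) = (\<Prod>i\<in>{1..n}. (gs ! (i - 1)) (\<sigma> i))"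
    (is "?X * ?Y = _") for \<sigma>
  proof -
    have "?Y = (\<Prod>i\<in>{1..n}. if i \<le> length lam then u (\<sigma> i) / (u (\<sigma> i) - s) else 1)"
      using assms by (intro prod.mono_neutral_cong_left) auto
    then show ?thesis
      unfolding prod.distrib[symmetric] using assms
      by (auto simp: gs_def nth_append part_def spin_factor_def simp flip: prod.distrib intro!: prod.cong)
  qed
  moreover have "length gs = n"
    using assms by (simp add: gs_def)
  ultimately show ?thesis
    using assms sum_permutes_eq_HL_sum[of gs n "HL_weight q u"]
    by (simp add: spin_HL_def HL_weight_def gs_def mult.assoc)
qed

text \<open>Numerator over the denominator \<open>spin_den\<close>, which depends on a bound
  \<open>m\<close> but not on the part \<open>l\<close>. The product of denominators is then the
  same for every ordering of the variables.\<close>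

definition spin_num :: "'a::idom \<Rightarrow> nat \<Rightarrow> nat \<Rightarrow> nat \<Rightarrow> 'a mpoly" where
  "spin_num s m l a = (poly_var a - poly_const s) ^ (l - 1) * poly_var a *
     (1 - poly_const s * poly_var a) ^ (m - l)"

definition spin_den :: "'a::idom \<Rightarrow> nat \<Rightarrow> nat \<Rightarrow> 'a mpoly" where
  "spin_den s m a = (1 - poly_const s * poly_var a) ^ m"

text \<open>At the origin the base takes the value 1, so setting only some variables to zero cannot
  make it vanish.\<close>

lemma spin_den_regular: "poly_set_zero I (spin_den s m a) \<noteq> 0"
proof -
  have "1 - poly_const s * p \<noteq> 0" if "poly_subst (\<lambda>_. 0) p = 0" for p :: "'a mpoly"
  proof
    assume "1 - poly_const s * p = 0"
    from arg_cong[OF this, of "poly_subst (\<lambda>_. 0)"] show False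
      by (simp add: poly_subst_mult that)
  qed
  then show ?thesis
    by (simp add: spin_den_def)
qed

text \<open>For \<open>l > 0\<close> the pole at \<open>u_a = s\<close> cancels. The factor
  \<open>u_a\<close> stays in the numerator, so the value at \<open>u_a = 0\<close> is 0 even for
  \<open>s = 0\<close>.\<close>

lemma spin_factor_eq_Fract:
  fixes s :: "'a::field"
  assumes "0 < l" "l \<le> m"
  shows "spin_factor (rf_const s) rf_var l a = Fract (spin_num s m l a) (spin_den s m a)"
proof -
  define x where "x = (poly_var a - poly_const s :: 'a mpoly)"
  define y where "y = (1 - poly_const s * poly_var a :: 'a mpoly)"
  have x: "x \<noteq> 0" using poly_var_neq_const[of a s] by (simp add: x_def)
  have y: "y \<noteq> 0" using spin_den_regular[of "{}" s 1 a] by (simp add: spin_den_def poly_set_zero_empty y_def)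
  obtain l' where l: "l = Suc l'" using assms(1) by (cases l) auto
  obtain d where m: "m = l + d" using assms(2) le_Suc_ex by blast
  have power: "Fract p d ^ n = Fract (p ^ n) (d ^ n)" for p d :: "'a mpoly" and n
    by (induction n) (simp_all add: One_fract_def)
  have "rf_var a - rf_const s = Fract x 1" "1 - rf_const s * rf_var a = Fract y 1"
    by (simp_all add: rf_var_def rf_const_def x_def y_def One_fract_def)
  then have "spin_factor (rf_const s) rf_var l a = Fract (x ^ l * poly_var a) (y ^ l * x)"
    by (simp add: spin_factor_def power) (simp add: rf_var_def)
  also have "\<dots> = Fract (x * (x ^ l' * poly_var a)) (x * y ^ l)"
    by (simp add: l mult_ac)
  \<comment> \<open>The common \<open>x\<close> is cancelled, and expanding by \<open>y ^ d\<close>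
    raises the denominator to the exponent \<open>m\<close>.\<close>
  also have "\<dots> = Fract (y ^ d * (x ^ l' * poly_var a)) (y ^ d * y ^ l)"
    using mult_fract_cancel[OF x] mult_fract_cancel[of "y ^ d"] y by simp
  also have "\<dots> = Fract (spin_num s m l a) (spin_den s m a)"
    by (simp add: spin_num_def spin_den_def x_def y_def l m power_add mult_ac)
  finally show ?thesis .
qed

section \<open>The eigenvalue relation\<close>

lemma poly_identify_transpose:
  "poly_identify k l (poly_var (transpose k l a)) = poly_identify k l (poly_var a)"
  by (auto simp: poly_identify_def transpose_def)

text \<open>The eigenvalue of \<open>HL_op\<close> itself is a q-binomial coefficient; the power of
  \<open>q\<close> turns it into \<open>elem_sym_geom\<close>. The conditions on \<open>q\<close>
  make this power and all \<open>qpoch\<close> invertible.\<close>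

theorem spin_HL_eigen:
  fixes q s :: "'a::field_char_0"
  assumes q: "q \<noteq> 0" "\<And>j. j > 0 \<Longrightarrow> q ^ j \<noteq> 1" and lam: "\<forall>x\<in>set lam. x > 0"
  shows "rf_const q ^ (r choose 2) *
       HL_op (rf_const q) n r (spin_HL (rf_const q) (rf_const s) lam n rf_var) =
     elem_sym_geom (rf_const q) r (n - length lam) * spin_HL (rf_const q) (rf_const s) lam n rf_var"
proof (cases "length lam \<le> n")
  case False
  then show ?thesis by (simp add: spin_HL_def HL_op_def)
next
  case True
  let ?Q = "rf_const q" and ?u = "rf_var :: nat \<Rightarrow> 'a ratfun"
  let ?w = "HL_weight ?Q ?u"
  let ?m = "n - length lam"
  define gs where "gs = map (spin_factor (rf_const s) ?u) lam"
  \<comment> \<open>A bound for all parts at once, defined also for the empty diagram.\<close>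
  define M where "M = sum_list lam"
  have lM: "0 < l" "l \<le> M" if "l \<in> set lam" for l
    using that lam member_le_sum_list[of l lam] by (auto simp: M_def)
  have Q: "?Q ^ j \<noteq> 1" if "j > 0" for j
    using q(2)[OF that] rf_const_eq_iff[of "q ^ j" 1] by (simp add: rf_const_power rf_const_hom)
  have Q0: "?Q \<noteq> 0"
    using q(1) rf_const_eq_iff[of q 0] by (simp add: rf_const_def poly_const_hom fract_collapse)
  have S: "finite {1..n}" "inj_on ?u {1..n}" "\<And>i. i \<in> {1..n} \<Longrightarrow> ?u i \<noteq> 0" "card {1..n} = length gs + ?m"
    using True by (auto simp: inj_on_def gs_def)
  have "qpoch q q j \<noteq> 0" for j
    using q(2) by (auto simp: qpoch_def simp flip: power_Suc)
  then have qpoch: "qpoch ?Q ?Q j \<noteq> 0" for j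
    using rf_const_eq_iff[of "qpoch q q j" 0]
    by (simp add: rf_const_qpoch) (simp add: rf_const_def poly_const_hom fract_collapse)
  have Q1: "1 - ?Q \<noteq> 0" using Q[of 1] by simp
  note full = HL_sum_append_ones[OF S, of ?Q]

  define F where "F = spin_HL ?Q (rf_const s) lam n ?u"
  define K where "K = (1 - q) ^ length lam"
  have F: "F = rf_const K * HL_sum ?w gs {1..n}"
  proof -
    have "(1 - ?Q) ^ n = (1 - ?Q) ^ length lam * (1 - ?Q) ^ ?m"
      using True by (simp flip: power_add)
    then have "F = (1 - ?Q) ^ length lam / qpoch ?Q ?Q ?m *
        ((1 - ?Q) ^ ?m * HL_sum ?w (gs @ replicate ?m (\<lambda>_. 1)) {1..n})"
      using spin_HL_eq_HL_sum[OF True, of ?Q "rf_const s" ?u] by (simp add: F_def gs_def)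
    also have "\<dots> = (1 - ?Q) ^ length lam / qpoch ?Q ?Q ?m * (qpoch ?Q ?Q ?m * HL_sum ?w gs {1..n})"
      by (simp only: full)
    finally show ?thesis
      using qpoch[of ?m] by (simp add: K_def rf_const_power rf_const_hom)
  qed
  \<comment> \<open>The alternation argument applies to full orderings, so regularity is shown for
    the list padded to length \<open>n\<close> and carried over to \<open>gs\<close> by a constant
    factor.\<close>
  have regular: "regular_at_zero I (HL_sum ?w gs {1..n})" for I
  proof -
    \<comment> \<open>At zero parts the factor 1 is written as \<open>spin_den\<close> over itself,
      to share the common denominator.\<close>
    define ps where "ps = map (spin_num s M) lam @ replicate ?m (spin_den s M)"
    have "regular_at_zero I (HL_sum ?w (map (\<lambda>p a. Fract (p a) (spin_den s M a)) ps) {1..n})"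
    proof (rule regular_HL_sum[OF _ _ spin_den_regular])
      fix p :: "nat \<Rightarrow> 'a mpoly" and k l a :: nat
      assume "p \<in> set ps" "k \<noteq> l"
      then show "poly_identify k l (p (transpose k l a)) = poly_identify k l (p a)"
        using poly_identify_transpose[of k l a, where 'a='a]
        by (auto simp: ps_def spin_num_def spin_den_def poly_identify_def poly_subst_mult)
    qed (use True in \<open>auto simp: ps_def\<close>)
    also have "map (\<lambda>p a. Fract (p a) (spin_den s M a)) ps = gs @ replicate ?m (\<lambda>_. 1)"
    proof -
      have "spin_den s M a \<noteq> 0" for a
        using spin_den_regular[of "{}" s M a] by (simp add: poly_set_zero_empty)
      then have "Fract (spin_den s M a) (spin_den s M a) = 1" for a
        by (simp add: One_fract_def eq_fract)
      then show ?thesis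
        using lM spin_factor_eq_Fract[of _ M s] by (auto simp: ps_def gs_def fun_eq_iff)
    qed
    finally have "regular_at_zero I (rf_const ((1 - q) ^ ?m / qpoch q q ?m) * HL_sum ?w (gs @ replicate ?m (\<lambda>_. 1)) {1..n})"
      by (intro T0_mult) auto
    also have "rf_const ((1 - q) ^ ?m / qpoch q q ?m) * HL_sum ?w (gs @ replicate ?m (\<lambda>_. 1)) {1..n} = HL_sum ?w gs {1..n}"
      using full qpoch[of ?m] by (simp add: rf_const_hom rf_const_power rf_const_qpoch field_simps)
    finally show ?thesis .
  qed
  have gs: "regular_at_zero {i} (g a) \<and> T0 {i} (g a) = (if a = i then 0 else g a)" if g: "g \<in> set gs" for g i a
  proof -
    obtain l where l: "l \<in> set lam" "g = spin_factor (rf_const s) ?u l"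
      using g by (auto simp: gs_def)
    then have g_eq: "g a = Fract (spin_num s M l a) (spin_den s M a)"
      using spin_factor_eq_Fract[OF lM[OF l(1)]] by simp
    have "regular_at_zero {i} (g a)"
      unfolding g_eq regular_at_zero_def using spin_den_regular by blast
    moreover have "poly_set_zero {i} (spin_num s M l a) = (if a = i then 0 else spin_num s M l a)"
      "a \<noteq> i \<Longrightarrow> poly_set_zero {i} (spin_den s M a) = spin_den s M a"
      by (simp_all add: spin_num_def spin_den_def)
    ultimately show ?thesis
      unfolding g_eq T0_Fract[OF spin_den_regular] by (simp add: fract_collapse)
  qed
  \<comment> \<open>Variables are set to zero one by one; \<open>regular\<close> for the whole set
    makes this agree with the simultaneous substitution.\<close>
  have T0_F: "T0 I F = rf_const K * HL_sum ?w gs ({1..n} - I)" if "I \<subseteq> {1..n}" for I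
  proof -
    have "finite I" using that finite_subset by blast
    then have "T0 I (HL_sum ?w gs {1..n}) = HL_sum ?w gs ({1..n} - I)"
    proof (induction I)
      case (insert i I)
      have "{1..n} - insert i I = {1..n} - I - {i}" by auto
      then show ?case
        using T0_insert(1)[OF regular[of "insert i I"]] insert T0_HL_sum[of "{1..n} - I" gs i q] gs
        by simp
    qed (simp add: T0_empty)
    then show ?thesis
      unfolding F using T0_mult(1)[OF regular_const regular[of I]] by simp
  qed
  \<comment> \<open>The q-binomial coefficient, the common value of the subset sums over all
    \<open>T\<close> of size \<open>n - length lam\<close>.\<close>
  define c where "c = elem_sym_geom ?Q r ?m / ?Q ^ (r choose 2)"
  have "HL_op ?Q n r F =
      (\<Sum>I | I \<subseteq> {1..n} \<and> card I = r. rf_const K * ((\<Prod>i\<in>I. \<Prod>j\<in>{1..n}-I. ?w j i) * HL_sum ?w gs ({1..n} - I)))"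
    unfolding HL_op_def
  proof (intro sum.cong refl)
    fix I assume "I \<in> {I. I \<subseteq> {1..n} \<and> card I = r}"
    moreover have "(?Q * ?u i - ?u j) / (?u i - ?u j) = ?w j i" for i j
      using minus_divide_divide[of "?u j - ?Q * ?u i" "?u j - ?u i"] by (simp add: HL_weight_def)
    ultimately show "(\<Prod>i\<in>I. \<Prod>j\<in>{1..n}-I. (?Q * ?u i - ?u j) / (?u i - ?u j)) * T0 I F =
        rf_const K * ((\<Prod>i\<in>I. \<Prod>j\<in>{1..n}-I. ?w j i) * HL_sum ?w gs ({1..n} - I))"
      by (simp add: T0_F)
  qed
  also have "\<dots> = rf_const K * (c * HL_sum ?w gs {1..n})"
    unfolding sum_distrib_left[symmetric]
  proof (intro arg_cong[of _ _ "(*) (rf_const K)"] sum_subsets_HL_sum)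
    fix T assume T: "T \<subseteq> {1..n}" "card T = card {1..n} - length gs"
    then have "?Q ^ (r choose 2) * (\<Sum>I | I \<subseteq> T \<and> card I = r. \<Prod>i\<in>I. \<Prod>j\<in>T-I. ?w j i) =
        elem_sym_geom ?Q r (card T)"
      by (intro sum_subsets_HL_weight) (auto intro: finite_subset simp: inj_on_def Q)
    then show "(\<Sum>I | I \<subseteq> T \<and> card I = r. \<Prod>i\<in>I. \<Prod>j\<in>T-I. ?w j i) = c"
      using T(2) Q0 by (simp add: c_def gs_def field_simps)
  qed simp
  finally have "HL_op ?Q n r F = c * F"
    by (simp add: F)
  then have "?Q ^ (r choose 2) * HL_op ?Q n r F = elem_sym_geom ?Q r ?m * F"
    using Q0 by (simp add: c_def)
  then show ?thesis
    by (simp only: F_def)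
qed

text \<open>\<open>q\<close> and \<open>s\<close> enter as constants of the field of rational
  functions over the complex numbers. The power of \<open>q\<close> on the left is the normalising
  prefactor absent from \<open>HL_op\<close>.\<close>

theorem theorem1p1:
  fixes q :: real and s :: complex and n r :: nat and lam :: "nat list"
  assumes "0 < q" and "q < 1"
    and "n \<ge> 1" and "young_diagram lam"
    and "1 \<le> r" and "r \<le> n"
  shows
    "rf_const (complex_of_real q) ^ (r choose 2) *
       HL_op (rf_const (complex_of_real q)) n r
         (spin_HL (rf_const (complex_of_real q)) (rf_const s) lam n rf_var) =
     elem_sym r (n - length lam) (\<lambda>i. rf_const (complex_of_real q) ^ (i - 1)) *
       spin_HL (rf_const (complex_of_real q)) (rf_const s) lam n rf_var"
proof (rule spin_HL_eigen)
  fix j :: nat assume "j > 0"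
  then have "q ^ j \<noteq> 1"
    using assms(1,2) power_less_one_iff[of q j] by auto
  then show "complex_of_real q ^ j \<noteq> 1"
    by (metis of_real_eq_1_iff of_real_power)
qed (use assms in \<open>auto simp: young_diagram_def\<close>)

end
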